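(* Assume $V$ satisfies (V.1) and (V.2). Then the quadratic form sum $H_{\mathrm{eff}}:=-\frac{\hbar^2}{2m}\Delta\dot{+}V_{\mathrm{eff}}$ exists on $L^2(\mathbb{R}^d)$; consequently $H_{\mathrm{eff}}$ is self-adjoint and bounded from below.
   Context: Let $d\ge2$, $\hbar,m,\epsilon_0>0$, $q\in\mathbb{R}\setminus\{0\}$. Let $\omega:\mathbb{R}^d\to[0,\infty)$ be Borel with $\omega>0$ a.e., and $\hat\rho:\mathbb{R}^d\to\mathbb{R}$ Borel, depending only on $|\boldsymbol{k}|$, with $\hat\rho/\omega^{1/2},\hat\rho/\omega^{3/2}\in L^2(\mathbb{R}^d)\setminus\{0\}$. Define $a:=\frac{d-1}{4d}\frac{\hbar q^2}{\epsilon_0 m^2}\int_{\mathbb{R}^d}\frac{|\hat\rho(\boldsymbol{k})|^2}{\omega(\boldsymbol{k})^3}d\boldsymbol{k}>0$. For a Borel $W:\mathbb{R}^d\to\mathbb{R}$ satisfying (V.2), define $W_{\mathrm{eff}}(\boldsymbol{x}):=(4\pi a)^{-d/2}\int_{\mathbb{R}^d}W(\boldsymbol{y})e^{-|\boldsymbol{x}-\boldsymbol{y}|^2/(4a)}d\boldsymbol{y}$ (absolutely convergent and continuous in $\boldsymbol{x}$). Conditions on a Borel $V:\mathbb{R}^d\to\mathbb{R}$: (V.1) either (V.1-1) $|V|$ is infinitesimally form-bounded with respect to $-\Delta$, or (V.1-2) $V$ is bounded from below; (V.2) $\int_{\mathbb{R}^d}|V(\boldsymbol{x})|e^{-t|\boldsymbol{x}|^2}d\boldsymbol{x}<\infty$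 for all $t>0$. $A\dot{+}B$ denotes the quadratic form sum. *)

theory Defs
  imports "HOL-Analysis.Analysis"
begin

definition L2 :: "(real^'n \<Rightarrow> complex) \<Rightarrow> bool" where
  "L2 f \<longleftrightarrow> f \<in> borel_measurable lborel \<and> integrable lborel (\<lambda>x. (cmod (f x))\<^sup>2)"

definition inner_L2 :: "(real^'n \<Rightarrow> complex) \<Rightarrow> (real^'n \<Rightarrow> complex) \<Rightarrow> complex" where
  "inner_L2 f g = (LINT x|lborel. cnj (f x) * g x)"

definition norm_L2 :: "(real^'n \<Rightarrow> complex) \<Rightarrow> real" where
  "norm_L2 f = sqrt (LINT x|lborel. (cmod (f x))\<^sup>2)"

definition dense_L2 :: "(real^'n \<Rightarrow> complex) set \<Rightarrow> bool" where
  "dense_L2 D \<longleftrightarrow> (\<forall>f. L2 f \<longrightarrow> (\<forall>e>0. \<exists>g\<in>D. norm_L2 (f - g) < e))"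

coinductive smooth_fun :: "(real^'n \<Rightarrow> real) \<Rightarrow> bool" where
  "\<lbrakk>\<forall>x. f differentiable (at x);
    \<forall>i. smooth_fun (\<lambda>x. frechet_derivative f (at x) (axis i 1))\<rbrakk> \<Longrightarrow> smooth_fun f"

definition pdiff :: "'n \<Rightarrow> (real^'n \<Rightarrow> real) \<Rightarrow> real^'n \<Rightarrow> real" where
  "pdiff i \<phi> x = frechet_derivative \<phi> (at x) (axis i 1)"

definition test_fun :: "(real^'n \<Rightarrow> real) \<Rightarrow> bool" where
  "test_fun \<phi> \<longleftrightarrow> smooth_fun \<phi> \<and> bounded {x. \<phi> x \<noteq> 0}"

definition weak_pd :: "'n \<Rightarrow> (real^'n \<Rightarrow> complex) \<Rightarrow> (real^'n \<Rightarrow> complex) \<Rightarrow> bool" where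
  "weak_pd i f g \<longleftrightarrow> (\<forall>\<phi>. test_fun \<phi> \<longrightarrow>
     (LINT x|lborel. f x * complex_of_real (pdiff i \<phi> x)) =
       - (LINT x|lborel. g x * complex_of_real (\<phi> x)))"

definition H1 :: "(real^'n \<Rightarrow> complex) \<Rightarrow> bool" where
  "H1 f \<longleftrightarrow> L2 f \<and> (\<forall>i. \<exists>g. L2 g \<and> weak_pd i f g)"

definition wgrad :: "'n \<Rightarrow> (real^'n \<Rightarrow> complex) \<Rightarrow> real^'n \<Rightarrow> complex" where
  "wgrad i f = (SOME g. L2 g \<and> weak_pd i f g)"

text \<open>Sesquilinear form of -Delta on its form domain H^1: sum_i <d_i f, d_i h>.\<close>
definition kin_form :: "(real^'n \<Rightarrow> complex) \<Rightarrow> (real^'n \<Rightarrow> complex) \<Rightarrow> complex" where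
  "kin_form f h = (\<Sum>i\<in>UNIV. inner_L2 (wgrad i f) (wgrad i h))"

definition inf_form_bounded :: "(real^'n \<Rightarrow> real) \<Rightarrow> bool" where
  "inf_form_bounded V \<longleftrightarrow>
     (\<forall>f. H1 f \<longrightarrow> integrable lborel (\<lambda>x. \<bar>V x\<bar> * (cmod (f x))\<^sup>2)) \<and>
     (\<forall>e>0. \<exists>b. \<forall>f. H1 f \<longrightarrow>
        (LINT x|lborel. \<bar>V x\<bar> * (cmod (f x))\<^sup>2) \<le> e * Re (kin_form f f) + b * (norm_L2 f)\<^sup>2)"

definition cond_V1 :: "(real^'n \<Rightarrow> real) \<Rightarrow> bool" where
  "cond_V1 V \<longleftrightarrow> inf_form_bounded V \<or> (\<exists>c. \<forall>x. c \<le> V x)"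

definition cond_V2 :: "(real^'n \<Rightarrow> real) \<Rightarrow> bool" where
  "cond_V2 V \<longleftrightarrow> (\<forall>t>0. integrable lborel (\<lambda>x. \<bar>V x\<bar> * exp (- t * (norm x)\<^sup>2)))"

definition W_eff :: "real \<Rightarrow> (real^'n \<Rightarrow> real) \<Rightarrow> real^'n \<Rightarrow> real" where
  "W_eff a W x = (4 * pi * a) powr (- real CARD('n) / 2) *
      (LINT y|lborel. W y * exp (- (norm (x - y))\<^sup>2 / (4 * a)))"

definition fs_dom :: "(real^'n \<Rightarrow> real) \<Rightarrow> (real^'n \<Rightarrow> complex) set" where
  "fs_dom W = {f. H1 f \<and> integrable lborel (\<lambda>x. \<bar>W x\<bar> * (cmod (f x))\<^sup>2)}"

definition fs_sesq :: "real \<Rightarrow> (real^'n \<Rightarrow> real) \<Rightarrow> (real^'n \<Rightarrow> complex) \<Rightarrow> (real^'n \<Rightarrow> complex) \<Rightarrow> complex" where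
  "fs_sesq c0 W f h = complex_of_real c0 * kin_form f h +
      (LINT x|lborel. complex_of_real (W x) * cnj (f x) * h x)"

definition fs_quad :: "real \<Rightarrow> (real^'n \<Rightarrow> real) \<Rightarrow> (real^'n \<Rightarrow> complex) \<Rightarrow> real" where
  "fs_quad c0 W f = Re (fs_sesq c0 W f f)"

text \<open>The form sum exists: the sum form on Q(-Delta) \<inter> Q(|W|) is densely defined,
  bounded from below and closed.\<close>
definition form_sum_exists :: "real \<Rightarrow> (real^'n \<Rightarrow> real) \<Rightarrow> bool" where
  "form_sum_exists c0 W \<longleftrightarrow>
     dense_L2 (fs_dom W) \<and>
     (\<exists>c. \<forall>f\<in>fs_dom W. c * (norm_L2 f)\<^sup>2 \<le> fs_quad c0 W f) \<and>
     (\<forall>fs f. (\<forall>n. fs n \<in> fs_dom W) \<longrightarrow> L2 f \<longrightarrow>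
        (\<lambda>n. norm_L2 (fs n - f)) \<longlonglongrightarrow> 0 \<longrightarrow>
        (\<forall>e>0. \<exists>N. \<forall>n\<ge>N. \<forall>m\<ge>N. \<bar>fs_quad c0 W (fs n - fs m)\<bar> < e) \<longrightarrow>
        f \<in> fs_dom W \<and> (\<lambda>n. fs_quad c0 W (fs n - f)) \<longlonglongrightarrow> 0)"

text \<open>Operator associated with the form (graph as a relation): H f = u.\<close>
definition fs_op :: "real \<Rightarrow> (real^'n \<Rightarrow> real) \<Rightarrow> (real^'n \<Rightarrow> complex) \<Rightarrow> (real^'n \<Rightarrow> complex) \<Rightarrow> bool" where
  "fs_op c0 W f u \<longleftrightarrow> f \<in> fs_dom W \<and> L2 u \<and> (\<forall>h\<in>fs_dom W. fs_sesq c0 W h f = inner_L2 h u)"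

definition adjoint_rel :: "((real^'n \<Rightarrow> complex) \<Rightarrow> (real^'n \<Rightarrow> complex) \<Rightarrow> bool) \<Rightarrow>
    (real^'n \<Rightarrow> complex) \<Rightarrow> (real^'n \<Rightarrow> complex) \<Rightarrow> bool" where
  "adjoint_rel T g w \<longleftrightarrow> L2 g \<and> L2 w \<and> (\<forall>f u. T f u \<longrightarrow> inner_L2 u g = inner_L2 f w)"

definition self_adjoint_rel :: "((real^'n \<Rightarrow> complex) \<Rightarrow> (real^'n \<Rightarrow> complex) \<Rightarrow> bool) \<Rightarrow> bool" where
  "self_adjoint_rel T \<longleftrightarrow> dense_L2 {f. \<exists>u. T f u} \<and> (\<forall>f u. T f u \<longleftrightarrow> adjoint_rel T f u)"

definition op_bounded_below :: "((real^'n \<Rightarrow> complex) \<Rightarrow> (real^'n \<Rightarrow> complex) \<Rightarrow> bool) \<Rightarrow> bool" where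
  "op_bounded_below T \<longleftrightarrow> (\<exists>c. \<forall>f u. T f u \<longrightarrow> c * (norm_L2 f)\<^sup>2 \<le> Re (inner_L2 f u))"

end

theory Submission
  imports Defs "HOL-Probability.Distributions" "HOL-Real_Asymp.Real_Asymp"
begin

text \<open>The Gaussian average V_eff inherits from V what the form sum needs. If |V| is infinitesimally
  form-bounded, Tonelli's theorem writes the weighted integral of |f|^2 against |V_eff| as a Gaussian
  average of the corresponding integrals for translates of f with weight |V|, and the kinetic form is
  translation invariant, so V_eff is form-bounded with relative bound as small as we please; if V is
  bounded below, so is V_eff. In both cases the kinetic form and the |V_eff|-integral are controlled
  by the sum form plus a multiple of the L2 norm. (V.2) makes V_eff locally bounded, so that the form
  domain contains the test functions. Closedness then follows from completeness of L2 and Fatou's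
  lemma, and self-adjointness from the Riesz representation in the form domain: T + K is symmetric
  and onto.\<close>

section \<open>Semi-inner products on function spaces\<close>

text \<open>Elements are functions rather than classes modulo null sets, so \<open>inner_L2\<close>,
  \<open>kin_form\<close> and the shifted form are only semi-inner products. One locale for possibly
  degenerate forms covers them all, and also a subspace of L2 whose density is in question.
  Minimization in it can only yield a Cauchy sequence; a limit is supplied case by case, by
  completeness of L2 and closedness of the form. The form itself may be indefinite, so the work is
  done with B = form + K * inner product. What makes this succeed is that B dominates the L2 norm,
  half of the kinetic energy and the |W|-integral separately: a sequence that is Cauchy for B is
  Cauchy for each of them, and each has its own limit theorem. Representatives have a price in two
  places. \<open>wgrad\<close> is a chosen weak derivative, so its linearity holds only almost
  everywhere. And the adjoint argument shows only that g agrees almost everywhere with an element f0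
  of the operator domain, after which membership and the operator equation have to be carried over
  from f0 to g.\<close>

locale form_space =
  fixes D :: "('a \<Rightarrow> complex) set" and B :: "('a \<Rightarrow> complex) \<Rightarrow> ('a \<Rightarrow> complex) \<Rightarrow> complex"
  assumes zero_mem: "(\<lambda>_. 0) \<in> D"
    and comb_mem: "f \<in> D \<Longrightarrow> g \<in> D \<Longrightarrow> (\<lambda>x. f x + c * g x) \<in> D"
    and B_comb: "h \<in> D \<Longrightarrow> f \<in> D \<Longrightarrow> g \<in> D \<Longrightarrow> B h (\<lambda>x. f x + c * g x) = B h f + c * B h g"
    and B_cnj: "f \<in> D \<Longrightarrow> g \<in> D \<Longrightarrow> B g f = cnj (B f g)"
    and B_nonneg: "f \<in> D \<Longrightarrow> 0 \<le> Re (B f f)"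
begin

lemma diff_mem: "f \<in> D \<Longrightarrow> g \<in> D \<Longrightarrow> f - g \<in> D"
  using comb_mem[of f g "-1"] by (simp add: fun_diff_def)

lemma B_diff: "h \<in> D \<Longrightarrow> f \<in> D \<Longrightarrow> g \<in> D \<Longrightarrow> B h (f - g) = B h f - B h g"
  using B_comb[of h f g "-1"] by (simp add: fun_diff_def)

lemma B_comb_left:
  assumes "h \<in> D" "f \<in> D" "g \<in> D"
  shows "B (\<lambda>x. f x + c * g x) h = B f h + cnj c * B g h"
  using assms B_cnj[of h "\<lambda>x. f x + c * g x"] B_cnj[of h f] B_cnj[of h g]
  by (simp add: comb_mem B_comb)

lemma B_diff_left: "h \<in> D \<Longrightarrow> f \<in> D \<Longrightarrow> g \<in> D \<Longrightarrow> B (f - g) h = B f h - B g h"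
  using B_comb_left[of h f g "-1"] by (simp add: fun_diff_def)

lemma B_comb_self:
  assumes "f \<in> D" "g \<in> D"
  shows "Re (B (\<lambda>x. f x + c * g x) (\<lambda>x. f x + c * g x)) =
    Re (B f f) + 2 * Re (c * B f g) + (cmod c)\<^sup>2 * Re (B g g)"
proof -
  have "B (\<lambda>x. f x + c * g x) (\<lambda>x. f x + c * g x) =
      B f f + c * B f g + cnj c * cnj (B f g) + (cnj c * c) * B g g"
    using assms by (simp add: comb_mem B_comb B_comb_left B_cnj[of f g] algebra_simps)
  moreover have "cnj c * c = of_real ((cmod c)\<^sup>2)"
    by (metis complex_norm_square mult.commute)
  moreover have "Re (cnj c * cnj (B f g)) = Re (c * B f g)"
    by (metis complex_cnj_mult complex_cnj_cnj complex.sel(1) cnj.simps(1))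
  ultimately show ?thesis by simp
qed

lemma B_diff_self:
  assumes "f \<in> D" "g \<in> D"
  shows "Re (B (f - g) (f - g)) = Re (B f f) - 2 * Re (B f g) + Re (B g g)"
  using B_comb_self[OF assms, of "-1"] by (simp add: fun_diff_def)

text \<open>\<open>B\<close> may be degenerate, so dividing by \<open>B g g\<close> is not always
  possible. Nonnegativity at f - t * cnj (B f g) * g for all real t gives a polynomial in t that
  settles both cases: if \<open>B g g\<close> vanishes it is affine, which forces
  \<open>B f g\<close> to vanish too.\<close>

lemma Cauchy_Schwarz:
  assumes "f \<in> D" "g \<in> D"
  shows "(cmod (B f g))\<^sup>2 \<le> Re (B f f) * Re (B g g)"
proof -
  define w where "w = cmod (B f g)"
  have key: "0 \<le> Re (B f f) - 2 * t * w\<^sup>2 + t\<^sup>2 * w\<^sup>2 * Re (B g g)" for t :: real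
  proof -
    let ?c = "- of_real t * cnj (B f g)"
    have "?c * B f g = of_real (- t * w\<^sup>2)"
      by (simp add: w_def complex_norm_square mult.commute del: of_real_power)
    then have "Re (?c * B f g) = - t * w\<^sup>2" by (metis Re_complex_of_real)
    moreover have "(cmod ?c)\<^sup>2 = t\<^sup>2 * w\<^sup>2" by (simp add: norm_mult w_def power_mult_distrib)
    ultimately show ?thesis
      using B_comb_self[OF assms, of ?c] B_nonneg[OF comb_mem[OF assms, of ?c]] by simp
  qed
  show ?thesis
  proof (cases "Re (B g g) = 0")
    case True
    have "w\<^sup>2 = 0"
    proof (rule ccontr)
      assume "w\<^sup>2 \<noteq> 0"
      \<comment> \<open>This t turns the linear term into -(\<open>Re (B f f)\<close> + 1), so
        \<open>key\<close> would read 0 <= -1.\<close>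
      then show False using key[of "(Re (B f f) + 1) / (2 * w\<^sup>2)"] True by simp
    qed
    then show ?thesis using True by (simp add: w_def)
  next
    case False
    then have pos: "Re (B g g) > 0" using B_nonneg[OF assms(2)] by simp
    have "0 \<le> Re (B f f) - w\<^sup>2 / Re (B g g)"
      using key[of "1 / Re (B g g)"] pos by (simp add: field_simps power2_eq_square)
    then show ?thesis using pos by (simp add: w_def field_simps)
  qed
qed

lemma B_tendsto:
  assumes d: "\<And>n. d n \<in> D" and f: "f \<in> D" and h: "h \<in> D"
    and lim: "(\<lambda>n. Re (B (d n - f) (d n - f))) \<longlonglongrightarrow> 0"
  shows "(\<lambda>n. B (d n) h) \<longlonglongrightarrow> B f h"
proof -
  have bound: "(cmod (B (d n) h - B f h))\<^sup>2 \<le> Re (B (d n - f) (d n - f)) * Re (B h h)" for n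
    using Cauchy_Schwarz[OF diff_mem[OF d f, of n] h] B_diff_left[OF h d f, of n] by simp
  have "(\<lambda>n. (cmod (B (d n) h - B f h))\<^sup>2) \<longlonglongrightarrow> 0"
    by (rule tendsto_sandwich[OF _ always_eventually[OF allI[OF bound]] tendsto_const
          tendsto_mult_left_zero[OF lim]]) simp
  then have "(\<lambda>n. sqrt ((cmod (B (d n) h - B f h))\<^sup>2)) \<longlonglongrightarrow> sqrt 0" by (rule tendsto_real_sqrt)
  then have "(\<lambda>n. B (d n) h - B f h) \<longlonglongrightarrow> 0" by (simp add: tendsto_norm_zero_iff)
  then show ?thesis by (rule LIM_zero_cancel)
qed

text \<open>Minimizing the energy J h = B h h - 2 Re (l h): the parallelogram law makes a minimizing
  sequence Cauchy, and comparing with perturbations d n + c h gives the Euler equation.\<close>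

lemma riesz_sequence:
  assumes l_comb: "\<And>f g c. f \<in> D \<Longrightarrow> g \<in> D \<Longrightarrow> l (\<lambda>x. f x + c * g x) = l f + c * l g"
    and l_bound: "\<And>f. f \<in> D \<Longrightarrow> (cmod (l f))\<^sup>2 \<le> C * Re (B f f)" and "C \<ge> 0"
  obtains d where "\<And>n. d n \<in> D"
    "\<And>e. e > 0 \<Longrightarrow> \<exists>N. \<forall>n\<ge>N. \<forall>m\<ge>N. Re (B (d n - d m) (d n - d m)) < e"
    "\<And>h. h \<in> D \<Longrightarrow> (\<lambda>n. B (d n) h) \<longlonglongrightarrow> l h"
proof -
  define J where "J h = Re (B h h) - 2 * Re (l h)" for h
  have J_ge: "- C \<le> J h" if "h \<in> D" for h
  proof -
    have "cmod (l h) \<le> sqrt (C * Re (B h h))"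
      using l_bound[OF that] by (simp add: real_le_rsqrt)
    moreover have "\<dots> \<le> (C + Re (B h h)) / 2"
      using arith_geo_mean_sqrt[OF \<open>C \<ge> 0\<close> B_nonneg[OF that]] .
    ultimately have "Re (l h) \<le> (C + Re (B h h)) / 2"
      using complex_Re_le_cmod[of "l h"] by (meson order_trans)
    then have "2 * Re (l h) \<le> C + Re (B h h)" by simp
    then show ?thesis by (simp add: J_def)
  qed
  define M where "M = Inf (J ` D)"
  have bdd: "bdd_below (J ` D)" using J_ge by (auto intro!: bdd_belowI[of _ "-C"])
  have M_le: "M \<le> J h" if "h \<in> D" for h
    unfolding M_def using bdd that by (simp add: cInf_lower)
  have "\<exists>h\<in>D. J h < M + 1 / Suc n" for n
  proof -
    have "Inf (J ` D) < M + 1 / Suc n" by (simp add: M_def)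
    then show ?thesis using cInf_less_iff[OF _ bdd] zero_mem by blast
  qed
  then obtain d where dD: "\<And>n. d n \<in> D" and dJ: "\<And>n. J (d n) < M + 1 / Suc n" by metis
  \<comment> \<open>The linear parts of \<open>J\<close> cancel against the midpoint, which leaves
    the parallelogram law for \<open>B\<close>. Since \<open>J\<close> is at least \<open>M\<close>
    at the midpoint, two near-minimizers are close.\<close>
  have par: "Re (B (x - y) (x - y)) = 2 * J x + 2 * J y - 4 * J (\<lambda>t. (1/2) * x t + (1/2) * y t)"
    and midD: "(\<lambda>t. (1/2) * x t + (1/2) * y t) \<in> D"
    if x: "x \<in> D" and y: "y \<in> D" for x y
  proof -
    have hx: "(\<lambda>t. (1/2) * x t) \<in> D" using comb_mem[OF zero_mem x, of "1/2"] by simp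
    show "(\<lambda>t. (1/2) * x t + (1/2) * y t) \<in> D" using comb_mem[OF hx y, of "1/2"] by simp
    have z: "B g (\<lambda>_. 0) = 0" "l (\<lambda>_. 0) = 0" if "g \<in> D" for g
      using B_comb[OF that zero_mem zero_mem, of 1] l_comb[OF zero_mem zero_mem, of 1] by simp_all
    have zl: "B (\<lambda>_. 0) g = 0" if "g \<in> D" for g
      using B_cnj[OF that zero_mem] z that by simp
    have 1: "Re (B (\<lambda>t. (1/2) * x t) (\<lambda>t. (1/2) * x t)) = Re (B x x) / 4"
      using B_comb_self[OF zero_mem x, of "1/2"] zl z zero_mem x by (simp add: power2_eq_square)
    have 2: "Re (B (\<lambda>t. (1/2) * x t) y) = Re (B x y) / 2"
    proof -
      have *: "B (\<lambda>t. (1/2) * x t) y = (1/2) * B x y"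
        using B_comb_left[OF y zero_mem x, of "1/2"] zl y by simp
      show ?thesis unfolding * by simp
    qed
    have 3: "Re (l (\<lambda>t. (1/2) * x t)) = Re (l x) / 2"
    proof -
      have *: "l (\<lambda>t. (1/2) * x t) = (1/2) * l x"
        using l_comb[OF zero_mem x, of "1/2"] z zero_mem by simp
      show ?thesis unfolding * by simp
    qed
    have "J (\<lambda>t. (1/2) * x t + (1/2) * y t) =
       Re (B x x) / 4 + Re (B x y) / 2 + Re (B y y) / 4 - Re (l x) - Re (l y)"
      unfolding J_def using B_comb_self[OF hx y, of "1/2"] l_comb[OF hx y, of "1/2"] 1 2 3
      by (simp add: power2_eq_square)
    then show "Re (B (x - y) (x - y)) = 2 * J x + 2 * J y - 4 * J (\<lambda>t. (1/2) * x t + (1/2) * y t)"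
      unfolding J_def B_diff_self[OF x y] by simp
  qed
  have cauchy: "\<exists>N. \<forall>n\<ge>N. \<forall>m\<ge>N. Re (B (d n - d m) (d n - d m)) < e" if "e > 0" for e
  proof -
    have "e / 4 > 0" using that by simp
    then obtain N where N: "1 / Suc N < e / 4" by (rule nat_approx_posE)
    show ?thesis
    proof (intro exI[of _ N] allI impI)
      fix n m assume nm: "n \<ge> N" "m \<ge> N"
      have "1 / Suc n \<le> 1 / Suc N" "1 / Suc m \<le> 1 / Suc N"
        using nm by (auto simp: field_simps)
      then have "J (d n) < M + e/4" "J (d m) < M + e/4"
        using dJ[of n] dJ[of m] N by linarith+
      then show "Re (B (d n - d m) (d n - d m)) < e"
        using par[OF dD[of n] dD[of m]] M_le[OF midD[OF dD[of n] dD[of m]]] by linarith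
    qed
  qed
  have euler: "(\<lambda>n. B (d n) h) \<longlonglongrightarrow> l h" if h: "h \<in> D" for h
  proof -
    \<comment> \<open>Step length of the perturbation: s * B h h <= 1 lets half of the linear gain
      absorb the quadratic term, and the 1 in the denominator covers B h h = 0.\<close>
    define s where "s = 1 / (1 + Re (B h h))"
    have Nh: "Re (B h h) \<ge> 0" using B_nonneg[OF h] .
    have s: "s > 0" "s * Re (B h h) \<le> 1" using Nh by (auto simp: s_def)
    have bound: "(cmod (B (d n) h - l h))\<^sup>2 \<le> (1 + Re (B h h)) * (1 / Suc n)" for n
    proof -
      define w where "w = B (d n) h - l h"
      let ?c = "- of_real s * cnj w"
      have cw: "Re (?c * w) = - s * (cmod w)\<^sup>2"
      proof -
        have "?c * w = of_real (- s * (cmod w)\<^sup>2)"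
          by (simp add: complex_norm_square mult.commute del: of_real_power)
        then show ?thesis by (metis Re_complex_of_real)
      qed
      have nc: "(cmod ?c)\<^sup>2 = s\<^sup>2 * (cmod w)\<^sup>2" by (simp add: norm_mult power_mult_distrib)
      have "J (\<lambda>x. d n x + ?c * h x) = J (d n) + 2 * Re (?c * w) + (cmod ?c)\<^sup>2 * Re (B h h)"
        unfolding J_def B_comb_self[OF dD h] l_comb[OF dD h] w_def by (simp add: algebra_simps)
      then have "0 \<le> 1 / Suc n - 2 * s * (cmod w)\<^sup>2 + s\<^sup>2 * (cmod w)\<^sup>2 * Re (B h h)"
        using M_le[OF comb_mem[OF dD h, of n ?c]] dJ[of n] cw nc by simp
      moreover have "s\<^sup>2 * (cmod w)\<^sup>2 * Re (B h h) \<le> s * (cmod w)\<^sup>2"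
      proof -
        have "s * (cmod w)\<^sup>2 * (s * Re (B h h)) \<le> s * (cmod w)\<^sup>2 * 1"
          using s by (intro mult_left_mono) auto
        then show ?thesis by (simp add: power2_eq_square mult_ac)
      qed
      ultimately have "s * (cmod w)\<^sup>2 \<le> 1 / Suc n" by linarith
      then have "(1 + Re (B h h)) * (s * (cmod w)\<^sup>2) \<le> (1 + Re (B h h)) * (1 / Suc n)"
        using Nh by (intro mult_left_mono) auto
      then show ?thesis using Nh by (simp add: s_def w_def)
    qed
    have lim: "(\<lambda>n. (1 + Re (B h h)) * (1 / Suc n)) \<longlonglongrightarrow> 0"
      using tendsto_mult_right_zero[OF LIMSEQ_inverse_real_of_nat] by (simp add: inverse_eq_divide)
    have "(\<lambda>n. (cmod (B (d n) h - l h))\<^sup>2) \<longlonglongrightarrow> 0"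
      by (rule tendsto_sandwich[OF _ always_eventually[OF allI[OF bound]] tendsto_const lim]) simp
    then have "(\<lambda>n. sqrt ((cmod (B (d n) h - l h))\<^sup>2)) \<longlonglongrightarrow> sqrt 0" by (rule tendsto_real_sqrt)
    then have "(\<lambda>n. cmod (B (d n) h - l h)) \<longlonglongrightarrow> 0" by simp
    then show ?thesis by (simp add: tendsto_norm_zero_iff LIM_zero_iff)
  qed
  show thesis by (rule that[OF dD cauchy euler])
qed

end

section \<open>The space of square-integrable functions\<close>

lemma cmod_add_sq_le: "(cmod (a + b))\<^sup>2 \<le> 2 * (cmod a)\<^sup>2 + 2 * (cmod b)\<^sup>2"
proof -
  have "(cmod (a + b))\<^sup>2 \<le> (cmod a + cmod b)\<^sup>2"
    by (intro power_mono norm_triangle_ineq) simp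
  also have "\<dots> \<le> 2 * (cmod a)\<^sup>2 + 2 * (cmod b)\<^sup>2"
    using sum_squares_bound[of "cmod a" "cmod b"] by (simp add: power2_sum)
  finally show ?thesis .
qed

lemma cmod_comb_sq_le: "(cmod (a + c * b))\<^sup>2 \<le> 2 * (cmod a)\<^sup>2 + 2 * (cmod c)\<^sup>2 * (cmod b)\<^sup>2"
  using cmod_add_sq_le[of a "c * b"] by (simp add: norm_mult power_mult_distrib)

lemma L2_borel: "L2 f \<Longrightarrow> f \<in> borel_measurable borel"
  by (simp add: L2_def)

lemma borel_measurable_cnj [measurable (raw)]:
  "f \<in> borel_measurable M \<Longrightarrow> (\<lambda>x. cnj (f x)) \<in> borel_measurable M"
  by (rule borel_measurable_continuous_on[OF continuous_on_cnj]) (auto intro: continuous_intros)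

lemma L2_comb:
  fixes f g :: "real^'n \<Rightarrow> complex"
  assumes "L2 f" "L2 g" shows "L2 (\<lambda>x. f x + c * g x)"
proof -
  note [measurable] = assms[THEN L2_borel]
  have "integrable lborel (\<lambda>x. (cmod (f x + c * g x))\<^sup>2)"
  proof (rule Bochner_Integration.integrable_bound)
    show "integrable lborel (\<lambda>x. 2 * (cmod (f x))\<^sup>2 + 2 * (cmod c)\<^sup>2 * (cmod (g x))\<^sup>2)"
      using assms by (auto simp: L2_def)
  qed (auto simp: cmod_comb_sq_le)
  then show ?thesis by (simp add: L2_def)
qed

lemma L2_zero: "L2 (\<lambda>_. 0)"
  by (simp add: L2_def)

lemma L2_mult_integrable:
  assumes "L2 f" "L2 g" shows "integrable lborel (\<lambda>x. cnj (f x) * g x)"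
proof (rule Bochner_Integration.integrable_bound)
  note [measurable] = assms[THEN L2_borel]
  show "integrable lborel (\<lambda>x. (cmod (f x))\<^sup>2 + (cmod (g x))\<^sup>2)"
    using assms by (auto simp: L2_def)
  show "(\<lambda>x. cnj (f x) * g x) \<in> borel_measurable lborel" by measurable
  have "cmod (f x) * cmod (g x) \<le> (cmod (f x))\<^sup>2 + (cmod (g x))\<^sup>2" for x
    using sum_squares_bound[of "cmod (f x)" "cmod (g x)"] mult_nonneg_nonneg[OF norm_ge_zero norm_ge_zero, of "f x" "g x"]
    by linarith
  then show "AE x in lborel. norm (cnj (f x) * g x) \<le> norm ((cmod (f x))\<^sup>2 + (cmod (g x))\<^sup>2)"
    by (simp add: norm_mult)
qed

lemma norm_L2_sq: "(norm_L2 f)\<^sup>2 = (LINT x|lborel. (cmod (f x))\<^sup>2)"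
  by (simp add: norm_L2_def)

lemma norm_L2_nonneg [simp]: "norm_L2 f \<ge> 0"
  by (simp add: norm_L2_def)

lemma inner_L2_self: "inner_L2 f f = of_real ((norm_L2 f)\<^sup>2)"
proof -
  have "inner_L2 f f = (LINT x|lborel. complex_of_real ((cmod (f x))\<^sup>2))"
    by (simp add: inner_L2_def complex_norm_square mult.commute del: of_real_power)
  then show ?thesis by (simp only: norm_L2_sq integral_complex_of_real)
qed

interpretation L2: form_space "Collect L2" inner_L2
proof
  fix f g h :: "real^'n \<Rightarrow> complex" and c
  show "(\<lambda>_. 0) \<in> Collect L2" by (simp add: L2_zero)
  show "0 \<le> Re (inner_L2 f f)" by (simp add: inner_L2_self)
  assume f: "f \<in> Collect L2" and g: "g \<in> Collect L2"
  then show "(\<lambda>x. f x + c * g x) \<in> Collect L2" by (simp add: L2_comb)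
  show "inner_L2 g f = cnj (inner_L2 f g)"
    unfolding inner_L2_def
    by (subst Bochner_Integration.integral_cnj[symmetric]) (simp add: mult.commute del: Bochner_Integration.integral_cnj)
  assume h: "h \<in> Collect L2"
  have "inner_L2 h (\<lambda>x. f x + c * g x) =
      (LINT x|lborel. cnj (h x) * f x + c * (cnj (h x) * g x))"
    unfolding inner_L2_def by (simp add: algebra_simps)
  also have "\<dots> = inner_L2 h f + c * inner_L2 h g"
    unfolding inner_L2_def using L2_mult_integrable f g h
    by (subst Bochner_Integration.integral_add) auto
  finally show "inner_L2 h (\<lambda>x. f x + c * g x) = inner_L2 h f + c * inner_L2 h g" .
qed

lemma L2_diff: "L2 f \<Longrightarrow> L2 g \<Longrightarrow> L2 (f - g)"
  using L2.diff_mem[of f g] by simp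

lemma norm_L2_minus_commute: "norm_L2 (f - g) = norm_L2 (g - f)"
  by (simp add: norm_L2_def norm_minus_commute)

lemma norm_L2_diff_sq_le:
  assumes "L2 f" "L2 g" "L2 h"
  shows "(norm_L2 (f - h))\<^sup>2 \<le> 2 * (norm_L2 (f - g))\<^sup>2 + 2 * (norm_L2 (g - h))\<^sup>2"
proof -
  have "(LINT x|lborel. (cmod (f x - h x))\<^sup>2) \<le>
     (LINT x|lborel. 2 * (cmod (f x - g x))\<^sup>2 + 2 * (cmod (g x - h x))\<^sup>2)"
  proof (rule integral_mono)
    show "(cmod (f x - h x))\<^sup>2 \<le> 2 * (cmod (f x - g x))\<^sup>2 + 2 * (cmod (g x - h x))\<^sup>2" for x
      using cmod_add_sq_le[of "f x - g x" "g x - h x"] by simp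
  qed (use L2_diff[OF assms(1,3)] L2_diff[OF assms(1,2)] L2_diff[OF assms(2,3)] in \<open>auto simp: L2_def\<close>)
  also have "\<dots> = 2 * (norm_L2 (f - g))\<^sup>2 + 2 * (norm_L2 (g - h))\<^sup>2"
    unfolding norm_L2_sq using L2_diff[OF assms(1,2)] L2_diff[OF assms(2,3)]
    by (subst Bochner_Integration.integral_add) (auto simp: L2_def)
  finally show ?thesis by (simp add: norm_L2_sq)
qed

lemma norm_L2_zero_AE: "L2 f \<Longrightarrow> norm_L2 f = 0 \<longleftrightarrow> (AE x in lborel. f x = 0)"
  unfolding norm_L2_def L2_def
  by (subst real_sqrt_eq_0_iff, subst integral_nonneg_eq_0_iff_AE) auto

lemma inner_L2_cong_AE:
  assumes "L2 f" "L2 f'" "L2 g" "L2 g'" "AE x in lborel. f x = f' x" "AE x in lborel. g x = g' x"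
  shows "inner_L2 f g = inner_L2 f' g'"
  unfolding inner_L2_def
proof (rule integral_cong_AE)
  note [measurable] = assms(1-4)[THEN L2_borel]
  show "(\<lambda>x. cnj (f x) * g x) \<in> borel_measurable lborel" by measurable
  show "(\<lambda>x. cnj (f' x) * g' x) \<in> borel_measurable lborel" by measurable
  show "AE x in lborel. cnj (f x) * g x = cnj (f' x) * g' x" using assms(5,6) by eventually_elim simp
qed

lemma inner_L2_tendsto:
  assumes "\<And>n. L2 (d n)" "L2 g" "L2 h" "(\<lambda>n. norm_L2 (d n - g)) \<longlonglongrightarrow> 0"
  shows "(\<lambda>n. inner_L2 (d n) h) \<longlonglongrightarrow> inner_L2 g h"
proof -
  have "(\<lambda>n. (norm_L2 (d n - g))\<^sup>2) \<longlonglongrightarrow> 0\<^sup>2" by (intro tendsto_intros assms(4))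
  then have "(\<lambda>n. Re (inner_L2 (d n - g) (d n - g))) \<longlonglongrightarrow> 0" by (simp add: inner_L2_self)
  then show ?thesis using assms(1-3) by (intro L2.B_tendsto) auto
qed

section \<open>Almost everywhere limits and completeness of L2\<close>

lemma norm_L2_AE_subseq:
  fixes d :: "nat \<Rightarrow> real^'n \<Rightarrow> complex"
  assumes "\<And>n. L2 (d n)" "L2 f" "(\<lambda>n. norm_L2 (d n - f)) \<longlonglongrightarrow> 0"
  obtains r where "strict_mono r" "AE x in lborel. (\<lambda>n. d (r n) x) \<longlonglongrightarrow> f x"
proof -
  have "(\<lambda>n. (norm_L2 (d n - f))\<^sup>2) \<longlonglongrightarrow> 0\<^sup>2" using assms(3) by (rule tendsto_power)
  then have "(\<lambda>n. LINT x|lborel. norm ((cmod (d n x - f x))\<^sup>2)) \<longlonglongrightarrow> 0" by (simp add: norm_L2_sq)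
  moreover have "integrable lborel (\<lambda>x. (cmod (d n x - f x))\<^sup>2)" for n
    using L2_diff[OF assms(1,2), of n] by (simp add: L2_def)
  ultimately obtain r where r: "strict_mono r"
      and ae: "AE x in lborel. (\<lambda>n. (cmod (d (r n) x - f x))\<^sup>2) \<longlonglongrightarrow> 0"
    using tendsto_L1_AE_subseq[of lborel "\<lambda>n x. (cmod (d n x - f x))\<^sup>2"] by blast
  from ae have "AE x in lborel. (\<lambda>n. d (r n) x) \<longlonglongrightarrow> f x"
  proof eventually_elim
    fix x assume "(\<lambda>n. (cmod (d (r n) x - f x))\<^sup>2) \<longlonglongrightarrow> 0"
    then have "(\<lambda>n. sqrt ((cmod (d (r n) x - f x))\<^sup>2)) \<longlonglongrightarrow> sqrt 0" by (rule tendsto_real_sqrt)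
    then show "(\<lambda>n. d (r n) x) \<longlonglongrightarrow> f x" by (simp add: tendsto_norm_zero_iff LIM_zero_iff)
  qed
  with r show thesis by (rule that)
qed

text \<open>Fatou's lemma; w = 1 gives completeness of L2, and the modulus of the potential as w gives
  closedness of the potential part of the form.\<close>

lemma weighted_Cauchy_limit:
  fixes d :: "nat \<Rightarrow> real^'n \<Rightarrow> complex" and w :: "real^'n \<Rightarrow> real"
  assumes [measurable]: "\<And>n. d n \<in> borel_measurable borel" "f \<in> borel_measurable borel"
      "w \<in> borel_measurable borel"
    and w: "\<And>x. w x \<ge> 0"
    and int: "\<And>n. integrable lborel (\<lambda>x. w x * (cmod (d n x))\<^sup>2)"
    and r: "strict_mono r" and ae: "AE x in lborel. (\<lambda>n. d (r n) x) \<longlonglongrightarrow> f x"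
    and cauchy: "\<And>e. e > 0 \<Longrightarrow> \<exists>N. \<forall>n\<ge>N. \<forall>m\<ge>N. (LINT x|lborel. w x * (cmod (d n x - d m x))\<^sup>2) < e"
  shows "integrable lborel (\<lambda>x. w x * (cmod (f x))\<^sup>2)"
    and "(\<lambda>n. LINT x|lborel. w x * (cmod (d n x - f x))\<^sup>2) \<longlonglongrightarrow> 0"
proof -
  have int2: "integrable lborel (\<lambda>x. w x * (cmod (d n x - d m x))\<^sup>2)" for n m
  proof (rule Bochner_Integration.integrable_bound)
    show "integrable lborel (\<lambda>x. 2 * (w x * (cmod (d n x))\<^sup>2) + 2 * (w x * (cmod (d m x))\<^sup>2))"
      using int by auto
    have "w x * (cmod (d n x - d m x))\<^sup>2 \<le> 2 * (w x * (cmod (d n x))\<^sup>2) + 2 * (w x * (cmod (d m x))\<^sup>2)" for x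
      using mult_left_mono[OF cmod_add_sq_le[of "d n x" "- d m x"] w[of x]] by (simp add: algebra_simps)
    then show "AE x in lborel. norm (w x * (cmod (d n x - d m x))\<^sup>2) \<le>
        norm (2 * (w x * (cmod (d n x))\<^sup>2) + 2 * (w x * (cmod (d m x))\<^sup>2))"
      using w by simp
  qed measurable
  \<comment> \<open>The limit along \<open>r\<close> is taken in the second index only, with
    \<open>n\<close> fixed; so the bound holds along the whole sequence and not just along the
    subsequence.\<close>
  have main: "integrable lborel (\<lambda>x. w x * (cmod (d n x - f x))\<^sup>2) \<and>
      (LINT x|lborel. w x * (cmod (d n x - f x))\<^sup>2) \<le> e"
    if "e > 0" and N: "\<forall>n\<ge>N. \<forall>m\<ge>N. (LINT x|lborel. w x * (cmod (d n x - d m x))\<^sup>2) < e"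
      and n: "n \<ge> N" for n N e
  proof -
    have "(\<integral>\<^sup>+x. ennreal (w x * (cmod (d n x - f x))\<^sup>2) \<partial>lborel) =
       (\<integral>\<^sup>+x. liminf (\<lambda>k. ennreal (w x * (cmod (d n x - d (r k) x))\<^sup>2)) \<partial>lborel)"
    proof (rule nn_integral_cong_AE, use ae in eventually_elim)
      fix x assume "(\<lambda>n. d (r n) x) \<longlonglongrightarrow> f x"
      then have "(\<lambda>k. ennreal (w x * (cmod (d n x - d (r k) x))\<^sup>2)) \<longlonglongrightarrow> ennreal (w x * (cmod (d n x - f x))\<^sup>2)"
        by (intro tendsto_intros)
      then show "ennreal (w x * (cmod (d n x - f x))\<^sup>2) = liminf (\<lambda>k. ennreal (w x * (cmod (d n x - d (r k) x))\<^sup>2))"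
        by (simp add: lim_imp_Liminf)
    qed
    also have "\<dots> \<le> liminf (\<lambda>k. \<integral>\<^sup>+x. ennreal (w x * (cmod (d n x - d (r k) x))\<^sup>2) \<partial>lborel)"
      by (rule nn_integral_liminf) measurable
    also have "\<dots> \<le> ennreal e"
    proof (rule Liminf_le[OF sequentially_bot], rule eventually_sequentiallyI[of N])
      fix k assume "k \<ge> N"
      then have "r k \<ge> N" using seq_suble[OF r, of k] by simp
      have "(\<integral>\<^sup>+x. ennreal (w x * (cmod (d n x - d (r k) x))\<^sup>2) \<partial>lborel) =
          ennreal (LINT x|lborel. w x * (cmod (d n x - d (r k) x))\<^sup>2)"
        using int2 w by (intro nn_integral_eq_integral) auto
      then show "(\<integral>\<^sup>+x. ennreal (w x * (cmod (d n x - d (r k) x))\<^sup>2) \<partial>lborel) \<le> ennreal e"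
        using N n \<open>r k \<ge> N\<close> by (simp add: ennreal_leI less_imp_le)
    qed
    finally have le: "(\<integral>\<^sup>+x. ennreal (w x * (cmod (d n x - f x))\<^sup>2) \<partial>lborel) \<le> ennreal e" .
    have i: "integrable lborel (\<lambda>x. w x * (cmod (d n x - f x))\<^sup>2)"
      using le w by (intro integrableI_nonneg) (auto simp: le_less_trans[OF _ ennreal_less_top])
    moreover have "(LINT x|lborel. w x * (cmod (d n x - f x))\<^sup>2) \<le> e"
      using le \<open>e > 0\<close> nn_integral_eq_integral[OF i] w by (simp add: ennreal_le_iff)
    ultimately show ?thesis by simp
  qed
  \<comment> \<open>Any finite bound will do here: f = d N - (d N - f) inherits integrability from
    its two terms.\<close>
  obtain N where N: "\<forall>n\<ge>N. \<forall>m\<ge>N. (LINT x|lborel. w x * (cmod (d n x - d m x))\<^sup>2) < 1"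
    using cauchy[of 1] by auto
  show "integrable lborel (\<lambda>x. w x * (cmod (f x))\<^sup>2)"
  proof (rule Bochner_Integration.integrable_bound)
    show "integrable lborel (\<lambda>x. 2 * (w x * (cmod (d N x))\<^sup>2) + 2 * (w x * (cmod (d N x - f x))\<^sup>2))"
      using int main[OF _ N, of N] by auto
    have "w x * (cmod (f x))\<^sup>2 \<le> 2 * (w x * (cmod (d N x))\<^sup>2) + 2 * (w x * (cmod (d N x - f x))\<^sup>2)" for x
      using mult_left_mono[OF cmod_add_sq_le[of "d N x" "f x - d N x"] w[of x]]
      by (simp add: algebra_simps norm_minus_commute)
    then show "AE x in lborel. norm (w x * (cmod (f x))\<^sup>2) \<le>
        norm (2 * (w x * (cmod (d N x))\<^sup>2) + 2 * (w x * (cmod (d N x - f x))\<^sup>2))"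
      using w by simp
  qed measurable
  show "(\<lambda>n. LINT x|lborel. w x * (cmod (d n x - f x))\<^sup>2) \<longlonglongrightarrow> 0"
  proof (rule LIMSEQ_I)
    fix e :: real assume "e > 0"
    then obtain N where N: "\<forall>n\<ge>N. \<forall>m\<ge>N. (LINT x|lborel. w x * (cmod (d n x - d m x))\<^sup>2) < e/2"
      using cauchy[of "e/2"] by auto
    have "norm ((LINT x|lborel. w x * (cmod (d n x - f x))\<^sup>2) - 0) < e" if "n \<ge> N" for n
    proof -
      have "(LINT x|lborel. w x * (cmod (d n x - f x))\<^sup>2) \<le> e/2"
        using main[OF _ N that] \<open>e > 0\<close> by simp
      moreover have "0 \<le> (LINT x|lborel. w x * (cmod (d n x - f x))\<^sup>2)"
        using w by (intro integral_nonneg_AE) auto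
      ultimately show ?thesis using \<open>e > 0\<close> by simp
    qed
    then show "\<exists>N. \<forall>n\<ge>N. norm ((LINT x|lborel. w x * (cmod (d n x - f x))\<^sup>2) - 0) < e" by blast
  qed
qed

lemma ennreal_term_le_suminf: "f k \<le> (\<Sum>k. f k :: ennreal)"
  using sum_le_suminf[of f "{k}"] by simp

text \<open>Along a subsequence whose squared increments are below 8^(-k), the series of 4^k times the squared
  pointwise increments has finite integral, so almost everywhere the increments are O(2^(-k)).\<close>

lemma L2_complete:
  fixes d :: "nat \<Rightarrow> real^'n \<Rightarrow> complex"
  assumes L2: "\<And>n. L2 (d n)"
    and cauchy: "\<And>e. e > 0 \<Longrightarrow> \<exists>N. \<forall>n\<ge>N. \<forall>m\<ge>N. (norm_L2 (d n - d m))\<^sup>2 < e"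
  obtains g where "L2 g" "(\<lambda>n. norm_L2 (d n - g)) \<longlonglongrightarrow> 0"
proof -
  note [measurable] = L2[THEN L2_borel]
  have "\<forall>k. \<exists>N. \<forall>n\<ge>N. \<forall>m\<ge>N. (norm_L2 (d n - d m))\<^sup>2 < (1/8)^k" using cauchy by simp
  then obtain M where M: "\<And>k n m. n \<ge> M k \<Longrightarrow> m \<ge> M k \<Longrightarrow> (norm_L2 (d n - d m))\<^sup>2 < (1/8)^k"
    by metis
  \<comment> \<open>The summand k makes \<open>r\<close> strictly increasing, and summing all M i up
    to k keeps r k above M k although \<open>M\<close> need not be monotone.\<close>
  define r where "r k = k + (\<Sum>i\<le>k. M i)" for k
  have r: "strict_mono r" by (rule strict_monoI_Suc) (simp add: r_def)
  have rM: "r k \<ge> M k" "r (Suc k) \<ge> M k" for k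
    using member_le_sum[of k "{..k}" M] by (auto simp: r_def intro: trans_le_add2 trans_le_add1)
  have int: "integrable lborel (\<lambda>x. (cmod (d n x - d m x))\<^sup>2)" for n m
    using L2_diff[OF L2 L2, of n m] by (simp add: L2_def)
  let ?D = "\<lambda>k x. (cmod (d (r k) x - d (r (Suc k)) x))\<^sup>2"
  have "(\<integral>\<^sup>+x. (\<Sum>k. ennreal (4^k * ?D k x)) \<partial>lborel) = (\<Sum>k. \<integral>\<^sup>+x. ennreal (4^k * ?D k x) \<partial>lborel)"
    by (rule nn_integral_suminf) measurable
  also have "\<dots> \<le> (\<Sum>k. ennreal ((1/2)^k))"
  proof (rule suminf_le)
    fix k
    have "(\<integral>\<^sup>+x. ennreal (4^k * ?D k x) \<partial>lborel) = ennreal (LINT x|lborel. 4^k * ?D k x)"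
      using int by (intro nn_integral_eq_integral) auto
    also have "(LINT x|lborel. 4^k * ?D k x) = 4^k * (norm_L2 (d (r k) - d (r (Suc k))))\<^sup>2"
      by (simp add: norm_L2_sq)
    also have "\<dots> \<le> 4^k * (1/8)^k" using M[OF rM] by (intro mult_left_mono less_imp_le) auto
    also have "\<dots> = (1/2)^k" by (simp add: power_mult_distrib[symmetric])
    finally show "(\<integral>\<^sup>+x. ennreal (4^k * ?D k x) \<partial>lborel) \<le> ennreal ((1/2)^k)"
      by (simp add: ennreal_leI)
  qed auto
  also have "\<dots> = ennreal (\<Sum>k. (1/2)^k)" by (rule suminf_ennreal2) auto
  finally have "(\<integral>\<^sup>+x. (\<Sum>k. ennreal (4^k * ?D k x)) \<partial>lborel) < \<infinity>"
    using le_less_trans[OF _ ennreal_less_top] by (simp add: infinity_ennreal_def)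
  then have "AE x in lborel. (\<Sum>k. ennreal (4^k * ?D k x)) \<noteq> \<infinity>"
    by (intro nn_integral_PInf_AE) auto
  then have conv: "AE x in lborel. convergent (\<lambda>k. d (r k) x)"
  proof eventually_elim
    fix x assume fin: "(\<Sum>k. ennreal (4^k * ?D k x)) \<noteq> \<infinity>"
    define C where "C = enn2real (\<Sum>k. ennreal (4^k * ?D k x))"
    have C: "C \<ge> 0" "(\<Sum>k. ennreal (4^k * ?D k x)) = ennreal C"
      unfolding C_def using fin by (simp_all only: enn2real_nonneg ennreal_enn2real top.not_eq_extremum infinity_ennreal_def)
    have bound: "norm (d (r (Suc k)) x - d (r k) x) \<le> sqrt C * (1/2)^k" for k
    proof -
      have "ennreal (4^k * ?D k x) \<le> (\<Sum>k. ennreal (4^k * ?D k x))"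
        by (rule ennreal_term_le_suminf)
      then have "4^k * ?D k x \<le> C" unfolding C(2) by (simp only: ennreal_le_iff[OF C(1)])
      moreover have "4^k * ?D k x = (2^k * cmod (d (r (Suc k)) x - d (r k) x))\<^sup>2"
      proof -
        have "(4::real)^k = (2^k)\<^sup>2" by (simp add: power2_eq_square flip: power_mult_distrib)
        then show ?thesis by (simp add: power_mult_distrib norm_minus_commute)
      qed
      ultimately have "2^k * cmod (d (r (Suc k)) x - d (r k) x) \<le> sqrt C"
        by (simp add: real_le_rsqrt)
      then show ?thesis by (simp add: field_simps)
    qed
    have "summable (\<lambda>k. sqrt C * (1/2)^k)"
      by (rule summable_mult[OF summable_geometric]) simp
    then have "summable (\<lambda>k. d (r (Suc k)) x - d (r k) x)"
      by (rule summable_comparison_test'[of _ 0]) (rule bound)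
    then have "convergent (\<lambda>n. \<Sum>k<n. d (r (Suc k)) x - d (r k) x)"
      by (rule summable_iff_convergent[THEN iffD1])
    then have "convergent (\<lambda>n. d (r n) x - d (r 0) x)"
      by (simp only: sum_lessThan_telescope[of "\<lambda>k. d (r k) x"])
    then show "convergent (\<lambda>n. d (r n) x)"
      using convergent_add_const_right_iff[of "\<lambda>n. d (r n) x" "- d (r 0) x"] by simp
  qed
  \<comment> \<open>Where the subsequence diverges, \<open>lim\<close> has an unspecified value;
    this concerns only a null set, and g is measurable all the same.\<close>
  define g where "g x = lim (\<lambda>k. d (r k) x)" for x
  have gm [measurable]: "g \<in> borel_measurable borel"
    unfolding g_def by (rule borel_measurable_lim_metric) measurable
  have ae: "AE x in lborel. (\<lambda>k. d (r k) x) \<longlonglongrightarrow> g x"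
    using conv by eventually_elim (simp add: g_def convergent_LIMSEQ_iff)
  \<comment> \<open>The factor 1 is the constant weight, in the shape that
    \<open>weighted_Cauchy_limit\<close> expects.\<close>
  have 1: "integrable lborel (\<lambda>x. 1 * (cmod (d n x))\<^sup>2)" for n using L2[of n] by (simp add: L2_def)
  have 2: "\<exists>N. \<forall>n\<ge>N. \<forall>m\<ge>N. (LINT x|lborel. 1 * (cmod (d n x - d m x))\<^sup>2) < e" if "e > 0" for e
    using cauchy[OF that] by (simp add: norm_L2_sq)
  have "L2 g" using weighted_Cauchy_limit(1)[OF _ _ _ _ 1 r ae 2] by (simp add: L2_def)
  moreover have "(\<lambda>n. (norm_L2 (d n - g))\<^sup>2) \<longlonglongrightarrow> 0"
    using weighted_Cauchy_limit(2)[OF _ _ _ _ 1 r ae 2] by (simp add: norm_L2_sq)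
  then have "(\<lambda>n. sqrt ((norm_L2 (d n - g))\<^sup>2)) \<longlonglongrightarrow> sqrt 0" by (rule tendsto_real_sqrt)
  then have "(\<lambda>n. norm_L2 (d n - g)) \<longlonglongrightarrow> 0" by simp
  ultimately show thesis by (rule that)
qed

text \<open>An orthogonal projection although \<open>D\<close> need not be closed: the Riesz
  sequence in \<open>D\<close> for the functional \<open>inner_L2 f\<close> converges in L2 to some
  g, possibly outside \<open>D\<close>, and g - f is orthogonal to \<open>D\<close>, hence null. So
  the sequence itself approximates f.\<close>

lemma dense_L2I:
  fixes D :: "(real^'n \<Rightarrow> complex) set"
  assumes D: "D \<subseteq> Collect L2" and z: "(\<lambda>_. 0) \<in> D"
    and comb: "\<And>f g c. f \<in> D \<Longrightarrow> g \<in> D \<Longrightarrow> (\<lambda>x. f x + c * g x) \<in> D"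
    and orth: "\<And>g. L2 g \<Longrightarrow> (\<And>h. h \<in> D \<Longrightarrow> inner_L2 g h = 0) \<Longrightarrow> AE x in lborel. g x = 0"
  shows "dense_L2 D"
  unfolding dense_L2_def
proof (intro allI impI)
  fix f :: "real^'n \<Rightarrow> complex" and e :: real
  assume f: "L2 f" and e: "e > 0"
  interpret S: form_space D inner_L2
  proof
    show "inner_L2 h (\<lambda>x. f x + c * g x) = inner_L2 h f + c * inner_L2 h g"
      if "h \<in> D" "f \<in> D" "g \<in> D" for f g h c
      using that D by (intro L2.B_comb) auto
    show "inner_L2 g f = cnj (inner_L2 f g)" if "f \<in> D" "g \<in> D" for f g
      using that D by (intro L2.B_cnj) auto
    show "0 \<le> Re (inner_L2 f f)" if "f \<in> D" for f
      using that D by (intro L2.B_nonneg) auto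
  qed (rule z, rule comb)
  have l1: "inner_L2 f (\<lambda>x. g x + c * h x) = inner_L2 f g + c * inner_L2 f h" if "g \<in> D" "h \<in> D" for g h c
    using that D f by (intro L2.B_comb) auto
  have l2: "(cmod (inner_L2 f g))\<^sup>2 \<le> (norm_L2 f)\<^sup>2 * Re (inner_L2 g g)" if "g \<in> D" for g
    using L2.Cauchy_Schwarz[of f g] that D f by (auto simp: inner_L2_self)
  obtain d where d: "\<And>n. d n \<in> D"
    and c: "\<And>e. e > 0 \<Longrightarrow> \<exists>N. \<forall>n\<ge>N. \<forall>m\<ge>N. Re (inner_L2 (d n - d m) (d n - d m)) < e"
    and l: "\<And>h. h \<in> D \<Longrightarrow> (\<lambda>n. inner_L2 (d n) h) \<longlonglongrightarrow> inner_L2 f h"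
    by (rule S.riesz_sequence[OF l1 l2 zero_le_power2]) (assumption | rule that)+
  have dL: "L2 (d n)" for n using d[of n] D by auto
  have c': "\<exists>N. \<forall>n\<ge>N. \<forall>m\<ge>N. (norm_L2 (d n - d m))\<^sup>2 < e" if "e > 0" for e
    using c[OF that] by (simp add: inner_L2_self)
  obtain g where g: "L2 g" and lim: "(\<lambda>n. norm_L2 (d n - g)) \<longlonglongrightarrow> 0"
    by (rule L2_complete[OF dL c']) (assumption | rule that)+
  have "inner_L2 (g - f) h = 0" if "h \<in> D" for h
  proof -
    have h: "L2 h" using that D by auto
    have "inner_L2 g h = inner_L2 f h"
      using LIMSEQ_unique[OF inner_L2_tendsto[OF dL g h lim] l[OF that]] .
    then show ?thesis using L2.B_diff_left[of h g f] g f h by simp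
  qed
  then have "AE x in lborel. (g - f) x = 0" using orth[OF L2_diff[OF g f]] by blast
  then have gf: "norm_L2 (g - f) = 0" using norm_L2_zero_AE[OF L2_diff[OF g f]] by simp
  have "(\<lambda>n. 2 * (norm_L2 (d n - g))\<^sup>2) \<longlonglongrightarrow> 2 * 0\<^sup>2" by (intro tendsto_intros lim)
  then have "\<forall>\<^sub>F n in sequentially. 2 * (norm_L2 (d n - g))\<^sup>2 < e\<^sup>2"
    by (rule order_tendstoD(2)) (use e in simp)
  then obtain n where "2 * (norm_L2 (d n - g))\<^sup>2 < e\<^sup>2" by (auto simp: eventually_sequentially)
  then have "(norm_L2 (d n - f))\<^sup>2 < e\<^sup>2"
    using norm_L2_diff_sq_le[OF dL[of n] g f] gf by simp
  then have "norm_L2 (d n - f) < e" using e by (metis power2_less_imp_less less_imp_le)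
  then show "\<exists>g\<in>D. norm_L2 (f - g) < e" using d norm_L2_minus_commute by metis
qed

section \<open>Test functions\<close>

text \<open>The derivatives of exp (-1/s) are combinations of the quotients exp (-1/s) / s^j; with
  the index j the family has all its derivatives in its own span.\<close>

definition gexp :: "nat \<Rightarrow> real \<Rightarrow> real" where
  "gexp j s = (if s > 0 then exp (- 1 / s) / s ^ j else 0)"

lemma gexp_tendsto_0: "(gexp j \<longlongrightarrow> 0) (at 0)"
proof -
  have "((\<lambda>s::real. exp (- 1 / s) / s ^ j) \<longlongrightarrow> 0) (at_right 0)" by real_asymp
  then have "(gexp j \<longlongrightarrow> 0) (at_right 0)"
    by (rule Lim_transform_eventually) (auto simp: gexp_def eventually_at_filter)
  moreover have "(gexp j \<longlongrightarrow> 0) (at_left 0)"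
    by (rule Lim_transform_eventually[OF tendsto_const]) (auto simp: gexp_def eventually_at_filter)
  ultimately show ?thesis by (simp add: filterlim_split_at)
qed

lemma gexp_deriv: "(gexp j has_real_derivative gexp (j + 2) s - real j * gexp (j + 1) s) (at s)"
proof -
  consider "s > 0" | "s < 0" | "s = 0" by linarith
  then show ?thesis
  proof cases
    case 1
    have "((\<lambda>s. exp (- 1 / s) / s ^ j) has_real_derivative gexp (j + 2) s - real j * gexp (j + 1) s) (at s)"
      using 1 by (auto intro!: derivative_eq_intros simp: gexp_def field_simps power2_eq_square)
        (cases j; simp add: field_simps)
    then show ?thesis
      by (rule has_field_derivative_transform_within_open[of _ _ _ "{0<..}"])
        (use 1 in \<open>auto simp: gexp_def\<close>)
  next
    case 2
    have "((\<lambda>_. 0) has_real_derivative gexp (j + 2) s - real j * gexp (j + 1) s) (at s)"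
      using 2 by (simp add: gexp_def)
    then show ?thesis
      by (rule has_field_derivative_transform_within_open[of _ _ _ "{..<0}"])
        (use 2 in \<open>auto simp: gexp_def\<close>)
  next
    case 3
    \<comment> \<open>At the gluing point the difference quotient of \<open>gexp j\<close> is
      \<open>gexp (Suc j)\<close>, whose limit is already known.\<close>
    have "((\<lambda>h. gexp j h / h) \<longlongrightarrow> 0) (at 0)"
      by (rule Lim_transform_eventually[OF gexp_tendsto_0[of "Suc j"]])
        (auto simp: gexp_def eventually_at_filter)
    then show ?thesis using 3 by (simp add: DERIV_def gexp_def)
  qed
qed

lemma gexp_0_bounds: "0 \<le> gexp 0 s" "gexp 0 s \<le> 1"
  by (auto simp: gexp_def)

text \<open>An algebra closed under partial derivatives: smoothness of its members is then a coinduction.\<close>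

inductive bump_alg :: "(real^'n \<Rightarrow> real) \<Rightarrow> bool" where
  const: "bump_alg (\<lambda>_. c)"
| gen: "bump_alg (\<lambda>x. gexp j (\<alpha> * x $ i + \<beta>))"
| add: "bump_alg f \<Longrightarrow> bump_alg g \<Longrightarrow> bump_alg (\<lambda>x. f x + g x)"
| mult: "bump_alg f \<Longrightarrow> bump_alg g \<Longrightarrow> bump_alg (\<lambda>x. f x * g x)"

lemma bump_alg_deriv:
  assumes "bump_alg f"
  shows "(\<forall>x. f differentiable (at x)) \<and> (\<forall>k. bump_alg (\<lambda>x. frechet_derivative f (at x) (axis k 1)))"
  using assms
proof induction
  case (const c)
  then show ?case by (simp add: bump_alg.const)
next
  case (gen j \<alpha> i \<beta>)
  have d: "((\<lambda>x. gexp j (\<alpha> * x $ i + \<beta>)) has_derivative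
      (\<lambda>h. (\<alpha> * h $ i) * (gexp (j + 2) (\<alpha> * x $ i + \<beta>) - real j * gexp (j + 1) (\<alpha> * x $ i + \<beta>)))) (at x)" for x
    by (rule DERIV_compose_FDERIV[OF gexp_deriv])
      (auto intro!: derivative_eq_intros bounded_linear_imp_has_derivative bounded_linear_vec_nth)
  \<comment> \<open>The derivative is written as a sum with the constant -j, since the algebra is
    generated by sums and products and has no rule for differences.\<close>
  have "bump_alg (\<lambda>x. (\<alpha> * axis k 1 $ i) * (gexp (j + 2) (\<alpha> * x $ i + \<beta>) +
      (- real j) * gexp (j + 1) (\<alpha> * x $ i + \<beta>)))" for k
    by (intro bump_alg.intros)
  then show ?case using d by (auto simp: differentiable_def frechet_derivative_at[OF d, symmetric])
next
  case (add f g)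
  have "frechet_derivative (\<lambda>x. f x + g x) (at x) =
      (\<lambda>h. frechet_derivative f (at x) h + frechet_derivative g (at x) h)" for x
    using add by (intro frechet_derivative_at[symmetric] has_derivative_add)
      (auto simp: frechet_derivative_works[symmetric])
  then show ?case using add by (auto intro!: bump_alg.add)
next
  case (mult f g)
  have "frechet_derivative (\<lambda>x. f x * g x) (at x) =
      (\<lambda>h. f x * frechet_derivative g (at x) h + frechet_derivative f (at x) h * g x)" for x
    using mult by (intro frechet_derivative_at[symmetric] has_derivative_mult)
      (auto simp: frechet_derivative_works[symmetric])
  then show ?case using mult by (auto intro!: bump_alg.intros)
qed

lemma bump_alg_smooth: "bump_alg f \<Longrightarrow> smooth_fun f"
  by (coinduction arbitrary: f) (use bump_alg_deriv in blast)

lemma bump_alg_prod: "finite I \<Longrightarrow> (\<And>i. i \<in> I \<Longrightarrow> bump_alg (F i)) \<Longrightarrow> bump_alg (\<lambda>x. \<Prod>i\<in>I. F i x)"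
  by (induction I rule: finite_induct) (auto intro: bump_alg.intros)

text \<open>Since exp (-1/s) tends to 1 as s grows, the dilation by \<open>Suc k\<close> flattens
  the product inside the box without enlarging its support: the bumps tend to the indicator of the
  open box and stay below it, as dominated convergence requires.\<close>

definition box_bump :: "real^'n \<Rightarrow> real^'n \<Rightarrow> nat \<Rightarrow> real^'n \<Rightarrow> real" where
  "box_bump a b k x = (\<Prod>i\<in>UNIV. gexp 0 (real (Suc k) * (x $ i - a $ i)) * gexp 0 (real (Suc k) * (b $ i - x $ i)))"

lemma box_bump_eq_0:
  fixes a b x :: "real^'n"
  assumes "x \<notin> box a b" shows "box_bump a b k x = 0"
proof -
  obtain i where "\<not> (a $ i < x $ i \<and> x $ i < b $ i)" using assms by (auto simp: mem_box_cart)
  then have "gexp 0 (real (Suc k) * (x $ i - a $ i)) * gexp 0 (real (Suc k) * (b $ i - x $ i)) = 0"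
    by (auto simp: gexp_def zero_less_mult_iff)
  then show ?thesis unfolding box_bump_def by (intro prod_zero) auto
qed

lemma box_bump_bounds: "0 \<le> box_bump a b k x" "box_bump a b k x \<le> 1"
  unfolding box_bump_def
  by (auto intro!: prod_nonneg prod_le_1 mult_le_one mult_nonneg_nonneg gexp_0_bounds)

lemma test_fun_box_bump: "test_fun (box_bump a b k)"
  unfolding test_fun_def
proof
  have "bump_alg (\<lambda>x. \<Prod>i\<in>UNIV. gexp 0 (real (Suc k) * x $ i + (- real (Suc k) * a $ i)) *
      gexp 0 ((- real (Suc k)) * x $ i + real (Suc k) * b $ i))"
    by (intro bump_alg_prod bump_alg.intros) auto
  then show "smooth_fun (box_bump a b k)"
    unfolding box_bump_def[abs_def] by (intro bump_alg_smooth) (simp add: algebra_simps)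
  show "bounded {x. box_bump a b k x \<noteq> 0}"
    by (rule bounded_subset[OF bounded_box[of a b]]) (use box_bump_eq_0 in blast)
qed

lemma box_bump_tendsto: "(\<lambda>k. box_bump a b k x) \<longlonglongrightarrow> indicator (box a b) x"
proof (cases "x \<in> box a b")
  case True
  have g: "(\<lambda>k. gexp 0 (real (Suc k) * c)) \<longlonglongrightarrow> 1" if "c > 0" for c
  proof -
    have "(\<lambda>k. exp (- (inverse (real (Suc k)) * (1 / c)))) \<longlonglongrightarrow> exp (- (0 * (1 / c)))"
      by (intro tendsto_intros LIMSEQ_inverse_real_of_nat)
    moreover have "gexp 0 (real (Suc k) * c) = exp (- (inverse (real (Suc k)) * (1 / c)))" for k
      using that by (simp add: gexp_def field_simps add_pos_nonneg)
    ultimately show ?thesis by simp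
  qed
  have "(\<lambda>k. box_bump a b k x) \<longlonglongrightarrow> (\<Prod>i\<in>(UNIV::'a set). 1 * 1)"
    unfolding box_bump_def using True by (intro tendsto_intros g) (auto simp: mem_box_cart)
  then show ?thesis using True by simp
qed (simp add: box_bump_eq_0)

text \<open>The positive and the negative part of u are densities of two measures that agree on open
  boxes. Boxes form an intersection-stable generator, and both measures are finite on an exhausting
  sequence of boxes; so the measures coincide, and then the densities do almost everywhere.\<close>

lemma AE_zero_of_box_integrals:
  fixes u :: "real^'n \<Rightarrow> real"
  assumes [measurable]: "u \<in> borel_measurable borel"
    and int: "\<And>a b. integrable lborel (\<lambda>x. u x * indicator (box a b) x)"
    and zero: "\<And>a b. (LINT x|lborel. u x * indicator (box a b) x) = 0"
  shows "AE x in lborel. u x = 0"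
proof -
  let ?E = "range (\<lambda>(a, b). box a b :: (real^'n) set)"
  \<comment> \<open>\<open>ennreal\<close> sends negative numbers to 0, so these densities are the
    positive and the negative part of u.\<close>
  let ?P = "density lborel (\<lambda>x. ennreal (u x))" and ?N = "density lborel (\<lambda>x. ennreal (- u x))"
  have split: "emeasure ?P (box a b) = ennreal (LINT x|lborel. max (u x) 0 * indicator (box a b) x)"
    "emeasure ?N (box a b) = ennreal (LINT x|lborel. max (- u x) 0 * indicator (box a b) x)"
    "(LINT x|lborel. max (u x) 0 * indicator (box a b) x) = (LINT x|lborel. max (- u x) 0 * indicator (box a b) x)"
    for a b
  proof -
    have i1: "integrable lborel (\<lambda>x. max (u x) 0 * indicator (box a b) x)"
      by (rule Bochner_Integration.integrable_bound[OF int[of a b]]) (auto simp: indicator_def)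
    have i2: "integrable lborel (\<lambda>x. max (- u x) 0 * indicator (box a b) x)"
      by (rule Bochner_Integration.integrable_bound[OF int[of a b]]) (auto simp: indicator_def)
    have e: "ennreal (max c 0) = ennreal c" for c by (simp add: max_def ennreal_neg)
    have "emeasure ?P (box a b) = (\<integral>\<^sup>+x. ennreal (max (u x) 0 * indicator (box a b) x) \<partial>lborel)"
      by (subst emeasure_density) (auto intro!: nn_integral_cong simp: e indicator_def)
    also have "\<dots> = ennreal (LINT x|lborel. max (u x) 0 * indicator (box a b) x)"
      by (rule nn_integral_eq_integral[OF i1]) auto
    finally show "emeasure ?P (box a b) = ennreal (LINT x|lborel. max (u x) 0 * indicator (box a b) x)" .
    have "emeasure ?N (box a b) = (\<integral>\<^sup>+x. ennreal (max (- u x) 0 * indicator (box a b) x) \<partial>lborel)"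
      by (subst emeasure_density) (auto intro!: nn_integral_cong simp: e indicator_def)
    also have "\<dots> = ennreal (LINT x|lborel. max (- u x) 0 * indicator (box a b) x)"
      by (rule nn_integral_eq_integral[OF i2]) auto
    finally show "emeasure ?N (box a b) = ennreal (LINT x|lborel. max (- u x) 0 * indicator (box a b) x)" .
    have "(\<lambda>x. max (u x) 0 * indicator (box a b) x - max (- u x) 0 * indicator (box a b) x) = (\<lambda>x. u x * indicator (box a b) x)"
      by (rule ext) (simp add: max_def indicator_def)
    then have "0 = (LINT x|lborel. max (u x) 0 * indicator (box a b) x - max (- u x) 0 * indicator (box a b) x)"
      using zero[of a b] by simp
    also have "\<dots> = (LINT x|lborel. max (u x) 0 * indicator (box a b) x) - (LINT x|lborel. max (- u x) 0 * indicator (box a b) x)"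
      by (rule Bochner_Integration.integral_diff[OF i1 i2])
    finally show "(LINT x|lborel. max (u x) 0 * indicator (box a b) x) = (LINT x|lborel. max (- u x) 0 * indicator (box a b) x)"
      by simp
  qed
  have "?P = ?N"
  proof (rule measure_eqI_generator_eq[where E="?E" and \<Omega>=UNIV and A="\<lambda>n::nat. box (- (real n *\<^sub>R One)) (real n *\<^sub>R One)"])
    show "Int_stable ?E" by (auto simp: Int_stable_def box_Int_box)
    show "sets ?P = sigma_sets UNIV ?E" "sets ?N = sigma_sets UNIV ?E" by (simp_all add: borel_eq_box)
    show "emeasure ?P X = emeasure ?N X" if "X \<in> ?E" for X using that split by auto
    show "(\<Union>n::nat. box (- (real n *\<^sub>R One)) (real n *\<^sub>R One)) = (UNIV :: (real^'n) set)"
      by (rule UN_box_eq_UNIV)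
    show "emeasure ?P (box (- (real n *\<^sub>R One)) (real n *\<^sub>R One)) \<noteq> \<infinity>" for n by (simp add: split)
  qed auto
  then have "AE x in lborel. ennreal (u x) = ennreal (- u x)"
    by (intro sigma_finite_measure.density_unique[OF sigma_finite_lborel]) auto
  then show ?thesis
    by eventually_elim (metis ennreal_eq_0_iff ennreal_neg linorder_le_cases neg_0_le_iff_le neg_le_0_iff_le order_antisym)
qed

lemma L2_mult_real_integrable:
  fixes f :: "real^'n \<Rightarrow> complex" and \<phi> :: "real^'n \<Rightarrow> real"
  assumes "L2 f" and [measurable]: "\<phi> \<in> borel_measurable borel" and "integrable lborel (\<lambda>x. (\<phi> x)\<^sup>2)"
  shows "integrable lborel (\<lambda>x. f x * complex_of_real (\<phi> x))"
proof -
  have "L2 (\<lambda>x. complex_of_real (\<phi> x))" using assms by (simp add: L2_def)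
  from L2_mult_integrable[OF this \<open>L2 f\<close>] show ?thesis by (simp add: mult.commute)
qed

text \<open>Box indicators are dominated limits of test functions, so orthogonality passes to boxes,
  where the real and the imaginary part are treated separately. Both the uniqueness of weak
  derivatives and the density of the form domain rest on this.\<close>

lemma test_fun_orthogonal_zero:
  fixes g :: "real^'n \<Rightarrow> complex"
  assumes g: "L2 g" and orth: "\<And>\<phi>. test_fun \<phi> \<Longrightarrow> (LINT x|lborel. g x * complex_of_real (\<phi> x)) = 0"
  shows "AE x in lborel. g x = 0"
proof -
  note [measurable] = L2_borel[OF g]
  have ibox: "integrable lborel (\<lambda>x. g x * complex_of_real (indicator (box a b) x))" for a b
  proof (rule L2_mult_real_integrable[OF g])
    have "(\<lambda>x. (indicator (box a b) x :: real)\<^sup>2) = indicator (box a b)" by (auto simp: indicator_def)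
    then show "integrable lborel (\<lambda>x. (indicator (box a b) x :: real)\<^sup>2)"
      by (simp, intro integrable_real_indicator) (auto simp: emeasure_bounded_finite[OF bounded_box, simplified])
  qed simp
  have zbox: "(LINT x|lborel. g x * complex_of_real (indicator (box a b) x)) = 0" for a b
  proof -
    have "(\<lambda>k. LINT x|lborel. g x * complex_of_real (box_bump a b k x)) \<longlonglongrightarrow>
        (LINT x|lborel. g x * complex_of_real (indicator (box a b) x))"
    proof (rule integral_dominated_convergence)
      show "integrable lborel (\<lambda>x. norm (g x * complex_of_real (indicator (box a b) x)))"
        using ibox by (rule integrable_norm)
      show "AE x in lborel. (\<lambda>k. g x * complex_of_real (box_bump a b k x)) \<longlonglongrightarrow> g x * complex_of_real (indicator (box a b) x)"
        by (intro AE_I2 tendsto_intros box_bump_tendsto)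
      show "AE x in lborel. norm (g x * complex_of_real (box_bump a b k x)) \<le> norm (g x * complex_of_real (indicator (box a b) x))" for k
        using box_bump_bounds[of a b k] box_bump_eq_0[of _ a b k]
        by (intro AE_I2) (auto simp: norm_mult indicator_def mult_left_le)
      show "(\<lambda>x. g x * complex_of_real (box_bump a b k x)) \<in> borel_measurable lborel" for k
        unfolding box_bump_def gexp_def by measurable
    qed measurable
    then have "(\<lambda>k. 0) \<longlonglongrightarrow> (LINT x|lborel. g x * complex_of_real (indicator (box a b) x))"
      by (simp only: orth[OF test_fun_box_bump])
    then show ?thesis by (simp add: LIMSEQ_const_iff)
  qed
  have "AE x in lborel. Re (g x) = 0"
  proof (rule AE_zero_of_box_integrals)
    show "integrable lborel (\<lambda>x. Re (g x) * indicator (box a b) x)" for a b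
      using integrable_Re[OF ibox[of a b]] by simp
    show "(LINT x|lborel. Re (g x) * indicator (box a b) x) = 0" for a b
      using integral_Re[OF ibox[of a b]] zbox by simp
  qed measurable
  moreover have "AE x in lborel. Im (g x) = 0"
  proof (rule AE_zero_of_box_integrals)
    show "integrable lborel (\<lambda>x. Im (g x) * indicator (box a b) x)" for a b
      using integrable_Im[OF ibox[of a b]] by simp
    show "(LINT x|lborel. Im (g x) * indicator (box a b) x) = 0" for a b
      using integral_Im[OF ibox[of a b]] zbox by simp
  qed measurable
  ultimately show ?thesis by eventually_elim (simp add: complex_eq_iff)
qed

section \<open>Weak derivatives and the kinetic form\<close>

lemma lborel_translate:
  fixes t :: "'a::euclidean_space" and f :: "'a \<Rightarrow> 'b::{banach, second_countable_topology}"
  assumes [measurable]: "f \<in> borel_measurable borel"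
  shows "(LINT x|lborel. f (x + t)) = (LINT x|lborel. f x)"
    and "integrable lborel (\<lambda>x. f (x + t)) \<longleftrightarrow> integrable lborel f"
proof -
  have d: "distr lborel borel (\<lambda>x. x + t) = lborel"
  proof -
    have "(\<lambda>x. x + t) = (+) t" by (auto simp: add.commute)
    then show ?thesis using lborel_distr_plus[of t] by simp
  qed
  show "(LINT x|lborel. f (x + t)) = (LINT x|lborel. f x)"
    by (subst (2) d[symmetric], subst integral_distr) auto
  show "integrable lborel (\<lambda>x. f (x + t)) \<longleftrightarrow> integrable lborel f"
    by (subst (2) d[symmetric], subst integrable_distr_eq) auto
qed

lemma smooth_fun_differentiable: "smooth_fun f \<Longrightarrow> f differentiable (at x)"
  by (erule smooth_fun.cases) simp

lemma smooth_fun_pdiff: "smooth_fun f \<Longrightarrow> smooth_fun (pdiff i f)"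
  by (erule smooth_fun.cases) (simp add: pdiff_def[abs_def])

lemma smooth_fun_continuous: "smooth_fun f \<Longrightarrow> continuous_on UNIV f"
  by (simp add: smooth_fun_differentiable continuous_at_imp_continuous_on differentiable_imp_continuous_within)

text \<open>Differentiation is local on the open complement of the closure, so a derivative cannot
  leave the closed support; this keeps \<open>test_fun\<close> stable under
  \<open>pdiff\<close>.\<close>

lemma pdiff_outside:
  assumes "x \<notin> closure {x. F x \<noteq> 0}" shows "pdiff i F x = 0"
proof -
  have "(F has_derivative (\<lambda>_. 0)) (at x)"
  proof (rule has_derivative_transform_within_open)
    show "((\<lambda>_. 0) has_derivative (\<lambda>_. 0)) (at x)" by simp
    show "open (- closure {x. F x \<noteq> 0})" "x \<in> - closure {x. F x \<noteq> 0}" using assms by auto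
    show "0 = F y" if "y \<in> - closure {x. F x \<noteq> 0}" for y
      using that closure_subset[of "{x. F x \<noteq> 0}"] by auto
  qed
  then show ?thesis by (simp add: pdiff_def frechet_derivative_at[symmetric])
qed

lemma test_fun_pdiff: "test_fun \<phi> \<Longrightarrow> test_fun (pdiff i \<phi>)"
  unfolding test_fun_def
proof
  assume "smooth_fun \<phi> \<and> bounded {x. \<phi> x \<noteq> 0}"
  moreover have "{x. pdiff i \<phi> x \<noteq> 0} \<subseteq> closure {x. \<phi> x \<noteq> 0}" using pdiff_outside by blast
  ultimately show "smooth_fun (pdiff i \<phi>)" "bounded {x. pdiff i \<phi> x \<noteq> 0}"
    using smooth_fun_pdiff bounded_subset[OF bounded_closure] by blast+
qed

lemma continuous_bounded_support_integrable:
  fixes f :: "real^'n \<Rightarrow> real"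
  assumes "continuous_on UNIV f" "bounded {x. f x \<noteq> 0}"
  shows "integrable lborel f"
proof -
  have "compact (closure {x. f x \<noteq> 0})" using assms(2) by simp
  then have "integrable lborel (\<lambda>x. indicator (closure {x. f x \<noteq> 0}) x *\<^sub>R f x)"
    using assms(1) by (intro borel_integrable_compact) (auto intro: continuous_on_subset)
  moreover have "(\<lambda>x. indicator (closure {x. f x \<noteq> 0}) x *\<^sub>R f x) = f"
    using closure_subset[of "{x. f x \<noteq> 0}"] by (auto simp: indicator_def fun_eq_iff)
  ultimately show ?thesis by simp
qed

text \<open>Difference quotients have integral zero by translation invariance; let the step tend to 0.\<close>

lemma integral_pdiff_zero:
  fixes F :: "real^'n \<Rightarrow> real"
  assumes diff: "\<And>x. F differentiable (at x)" and cont: "continuous_on UNIV (pdiff i F)"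
    and bdd: "bounded {x. F x \<noteq> 0}"
  shows "(LINT x|lborel. pdiff i F x) = 0"
proof -
  let ?e = "axis i 1 :: real^'n"
  have Fc: "continuous_on UNIV F"
    using diff by (simp add: continuous_at_imp_continuous_on differentiable_imp_continuous_within)
  note [measurable] = borel_measurable_continuous_onI[OF Fc] borel_measurable_continuous_onI[OF cont]
  have Fi: "integrable lborel F" using continuous_bounded_support_integrable[OF Fc bdd] .
  obtain R where R: "\<And>x. F x \<noteq> 0 \<Longrightarrow> norm x \<le> R" using bdd by (auto simp: bounded_iff)
  \<comment> \<open>All steps have length at most 1. For |x| <= R + 1 the mean value point lies in
    the ball of radius R + 2, where the derivative is bounded; for |x| > R + 1 both ends of the step
    miss the support. Hence |M| on the ball of radius R + 1 dominates every quotient.\<close>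
  have "compact (pdiff i F ` cball 0 (R + 2))"
    using cont by (intro compact_continuous_image) (auto intro: continuous_on_subset)
  then obtain M where "\<forall>x\<in>cball 0 (R + 2). \<bar>pdiff i F x\<bar> \<le> M"
    by (auto dest!: compact_imp_bounded simp: bounded_iff)
  then have M: "\<bar>pdiff i F x\<bar> \<le> M" if "norm x \<le> R + 2" for x using that by simp
  have deriv: "((\<lambda>t. F (x + t *\<^sub>R ?e)) has_real_derivative pdiff i F (x + t *\<^sub>R ?e)) (at t)" for x t
  proof -
    let ?F' = "frechet_derivative F (at (x + t *\<^sub>R ?e))"
    have F': "(F has_derivative ?F') (at (x + t *\<^sub>R ?e))"
      using diff by (simp add: frechet_derivative_works[symmetric])
    have "((\<lambda>t. F (x + t *\<^sub>R ?e)) has_derivative (\<lambda>h. ?F' (h *\<^sub>R ?e))) (at t)"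
      by (rule has_derivative_compose[of "\<lambda>t. x + t *\<^sub>R ?e" _ _ _ F, OF _ F']) (auto intro!: derivative_eq_intros)
    moreover have "?F' (h *\<^sub>R ?e) = h * pdiff i F (x + t *\<^sub>R ?e)" for h
      using linear_scale[OF has_derivative_linear[OF F']] by (simp add: pdiff_def)
    ultimately show ?thesis by (simp add: has_field_derivative_def mult.commute[of _ "pdiff i F (x + t *\<^sub>R ?e)"])
  qed
  let ?s = "\<lambda>n. inverse (real (Suc n))"
  let ?Q = "\<lambda>n x. (F (x + ?s n *\<^sub>R ?e) - F x) / ?s n"
  have Q0: "(LINT x|lborel. ?Q n x) = 0" for n
    using Fi lborel_translate[of F "?s n *\<^sub>R ?e"] by (simp add: Bochner_Integration.integral_diff)
  have "(\<lambda>n. LINT x|lborel. ?Q n x) \<longlonglongrightarrow> (LINT x|lborel. pdiff i F x)"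
  proof (rule integral_dominated_convergence)
    show "integrable lborel (\<lambda>x. indicator (cball 0 (R + 1)) x *\<^sub>R \<bar>M\<bar>)"
      by (intro borel_integrable_compact) auto
    show "AE x in lborel. (\<lambda>n. ?Q n x) \<longlonglongrightarrow> pdiff i F x"
    proof (rule AE_I2)
      fix x
      have lim: "((\<lambda>h. (F (x + h *\<^sub>R ?e) - F x) / h) \<longlongrightarrow> pdiff i F x) (at 0)"
        using deriv[of x 0] by (simp add: DERIV_def)
      have s: "filterlim ?s (at 0) sequentially"
        using LIMSEQ_inverse_real_of_nat by (simp add: filterlim_at)
      show "(\<lambda>n. ?Q n x) \<longlonglongrightarrow> pdiff i F x"
        using filterlim_compose[OF lim s] by simp
    qed
    fix n
    show "AE x in lborel. norm (?Q n x) \<le> indicator (cball 0 (R + 1)) x *\<^sub>R \<bar>M\<bar>"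
    proof (rule AE_I2)
      fix x :: "real^'n"
      have s: "0 < ?s n" "?s n \<le> 1" by (auto simp: field_simps)
      have ns: "norm (z *\<^sub>R ?e) = z" if "z \<ge> 0" for z using that by simp
      show "norm (?Q n x) \<le> indicator (cball 0 (R + 1)) x *\<^sub>R \<bar>M\<bar>"
      proof (cases "norm x \<le> R + 1")
        case True
        obtain z where z: "0 < z" "z < ?s n" and "F (x + ?s n *\<^sub>R ?e) - F (x + 0 *\<^sub>R ?e) = (?s n - 0) * pdiff i F (x + z *\<^sub>R ?e)"
          using MVT2[OF s(1), of "\<lambda>t. F (x + t *\<^sub>R ?e)" "\<lambda>t. pdiff i F (x + t *\<^sub>R ?e)"] deriv by blast
        then have "?Q n x = pdiff i F (x + z *\<^sub>R ?e)" using s by simp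
        moreover have "norm (x + z *\<^sub>R ?e) \<le> R + 2"
          using norm_triangle_ineq[of x "z *\<^sub>R ?e"] ns[of z] z s True by linarith
        ultimately show ?thesis using M[of "x + z *\<^sub>R ?e"] True by simp
      next
        case False
        have "norm (x + ?s n *\<^sub>R ?e) > R"
          using norm_triangle_ineq4[of "x + ?s n *\<^sub>R ?e" "?s n *\<^sub>R ?e"] ns[of "?s n"] s False by simp
        then have "F (x + ?s n *\<^sub>R ?e) = 0" "F x = 0" using R[of x] R[of "x + ?s n *\<^sub>R ?e"] False by auto
        then show ?thesis by simp
      qed
    qed
  qed measurable
  then have "(\<lambda>n. 0) \<longlonglongrightarrow> (LINT x|lborel. pdiff i F x)" by (simp only: Q0)
  then show ?thesis by (simp add: LIMSEQ_const_iff)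
qed

lemma test_fun_continuous: "test_fun \<phi> \<Longrightarrow> continuous_on UNIV \<phi>"
  by (simp add: test_fun_def smooth_fun_continuous)

lemma test_fun_borel: "test_fun \<phi> \<Longrightarrow> \<phi> \<in> borel_measurable borel"
  by (rule borel_measurable_continuous_onI[OF test_fun_continuous])

lemma test_fun_mult_integrable:
  fixes \<phi> \<psi> :: "real^'n \<Rightarrow> real"
  assumes "test_fun \<phi>" "test_fun \<psi>" shows "integrable lborel (\<lambda>x. \<phi> x * \<psi> x)"
proof (rule continuous_bounded_support_integrable)
  show "continuous_on UNIV (\<lambda>x. \<phi> x * \<psi> x)"
    using assms by (intro continuous_intros test_fun_continuous)
  show "bounded {x. \<phi> x * \<psi> x \<noteq> 0}"
    by (rule bounded_subset[of "{x. \<phi> x \<noteq> 0}"]) (use assms in \<open>auto simp: test_fun_def\<close>)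
qed

lemma test_fun_L2: "test_fun \<phi> \<Longrightarrow> L2 (\<lambda>x. complex_of_real (\<phi> x))"
  using test_fun_mult_integrable[of \<phi> \<phi>] test_fun_borel[of \<phi>]
  by (simp add: L2_def power2_eq_square)

text \<open>The product of two test functions has partial derivatives of integral zero; expanded by
  the product rule, this is integration by parts without a boundary term.\<close>

lemma test_fun_weak_pd:
  fixes \<phi> :: "real^'n \<Rightarrow> real"
  assumes \<phi>: "test_fun \<phi>"
  shows "weak_pd i (\<lambda>x. complex_of_real (\<phi> x)) (\<lambda>x. complex_of_real (pdiff i \<phi> x))"
  unfolding weak_pd_def
proof (intro allI impI)
  fix \<psi> :: "real^'n \<Rightarrow> real" assume \<psi>: "test_fun \<psi>"
  note d = \<phi>[THEN test_fun_pdiff, of i] \<psi>[THEN test_fun_pdiff, of i]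
  have pd: "pdiff i (\<lambda>x. \<phi> x * \<psi> x) = (\<lambda>x. \<phi> x * pdiff i \<psi> x + pdiff i \<phi> x * \<psi> x)"
  proof
    fix x
    have "frechet_derivative (\<lambda>x. \<phi> x * \<psi> x) (at x) =
      (\<lambda>h. \<phi> x * frechet_derivative \<psi> (at x) h + frechet_derivative \<phi> (at x) h * \<psi> x)"
      using \<phi> \<psi> by (intro frechet_derivative_at[symmetric] has_derivative_mult)
        (auto simp: frechet_derivative_works[symmetric] test_fun_def smooth_fun_differentiable)
    then show "pdiff i (\<lambda>x. \<phi> x * \<psi> x) x = \<phi> x * pdiff i \<psi> x + pdiff i \<phi> x * \<psi> x"
      by (simp add: pdiff_def)
  qed
  have "(LINT x|lborel. pdiff i (\<lambda>x. \<phi> x * \<psi> x) x) = 0"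
  proof (rule integral_pdiff_zero)
    show "(\<lambda>x. \<phi> x * \<psi> x) differentiable at x" for x
      using \<phi> \<psi> by (auto simp: test_fun_def smooth_fun_differentiable)
    show "continuous_on UNIV (pdiff i (\<lambda>x. \<phi> x * \<psi> x))"
      unfolding pd using \<phi> \<psi> d by (intro continuous_intros test_fun_continuous)
    show "bounded {x. \<phi> x * \<psi> x \<noteq> 0}"
      by (rule bounded_subset[of "{x. \<phi> x \<noteq> 0}"]) (use \<phi> in \<open>auto simp: test_fun_def\<close>)
  qed
  then have "(LINT x|lborel. \<phi> x * pdiff i \<psi> x) = - (LINT x|lborel. pdiff i \<phi> x * \<psi> x)"
    unfolding pd using \<phi> \<psi> d
    by (subst (asm) Bochner_Integration.integral_add) (auto intro: test_fun_mult_integrable)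
  then show "(LINT x|lborel. complex_of_real (\<phi> x) * complex_of_real (pdiff i \<psi> x)) =
      - (LINT x|lborel. complex_of_real (pdiff i \<phi> x) * complex_of_real (\<psi> x))"
    unfolding of_real_mult[symmetric] integral_complex_of_real by simp
qed

lemma test_fun_H1:
  assumes "test_fun \<phi>" shows "H1 (\<lambda>x. complex_of_real (\<phi> x))"
  unfolding H1_def
proof (intro conjI allI exI)
  show "L2 (\<lambda>x. complex_of_real (\<phi> x))" using assms by (rule test_fun_L2)
  show "L2 (\<lambda>x. complex_of_real (pdiff i \<phi> x))" for i using assms by (intro test_fun_L2 test_fun_pdiff)
  show "weak_pd i (\<lambda>x. complex_of_real (\<phi> x)) (\<lambda>x. complex_of_real (pdiff i \<phi> x))" for i
    using assms by (rule test_fun_weak_pd)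
qed

lemma L2_test_fun_integrable:
  "L2 f \<Longrightarrow> test_fun \<phi> \<Longrightarrow> integrable lborel (\<lambda>x. f x * complex_of_real (\<phi> x))"
  using test_fun_mult_integrable[of \<phi> \<phi>]
  by (intro L2_mult_real_integrable test_fun_borel) (auto simp: power2_eq_square)

section \<open>Weak gradients and the space H1\<close>

lemma weak_pd_comb:
  assumes "L2 f" "L2 g" "L2 f'" "L2 g'" "weak_pd i f f'" "weak_pd i g g'"
  shows "weak_pd i (\<lambda>x. f x + c * g x) (\<lambda>x. f' x + c * g' x)"
  unfolding weak_pd_def
proof (intro allI impI)
  fix \<phi> :: "real^'a \<Rightarrow> real" assume \<phi>: "test_fun \<phi>"
  have comb: "(LINT x|lborel. (u x + c * v x) * complex_of_real (\<psi> x)) =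
      (LINT x|lborel. u x * complex_of_real (\<psi> x)) + c * (LINT x|lborel. v x * complex_of_real (\<psi> x))"
    if "L2 u" "L2 v" "test_fun \<psi>" for u v :: "real^'a \<Rightarrow> complex" and \<psi>
    using L2_test_fun_integrable[OF that(1,3)] L2_test_fun_integrable[OF that(2,3)]
    by (simp add: ring_distribs mult.assoc)
  show "(LINT x|lborel. (f x + c * g x) * complex_of_real (pdiff i \<phi> x)) =
      - (LINT x|lborel. (f' x + c * g' x) * complex_of_real (\<phi> x))"
    using assms \<phi> test_fun_pdiff[OF \<phi>, of i] by (simp add: comb weak_pd_def)
qed

lemma weak_pd_unique:
  assumes "L2 g" "L2 g'" "weak_pd i f g" "weak_pd i f g'"
  shows "AE x in lborel. g x = g' x"
proof -
  have "AE x in lborel. (g - g') x = 0"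
  proof (rule test_fun_orthogonal_zero[OF L2_diff[OF assms(1,2)]])
    fix \<phi> :: "real^'a \<Rightarrow> real" assume \<phi>: "test_fun \<phi>"
    have "(LINT x|lborel. g x * complex_of_real (\<phi> x)) = (LINT x|lborel. g' x * complex_of_real (\<phi> x))"
      using assms(3,4) \<phi> unfolding weak_pd_def by (metis neg_equal_iff_equal)
    then show "(LINT x|lborel. (g - g') x * complex_of_real (\<phi> x)) = 0"
      using L2_test_fun_integrable[OF assms(1) \<phi>] L2_test_fun_integrable[OF assms(2) \<phi>]
      by (simp add: left_diff_distrib)
  qed
  then show ?thesis by simp
qed

lemma wgrad_spec:
  assumes "H1 f" shows "L2 (wgrad i f)" "weak_pd i f (wgrad i f)"
proof -
  have "\<exists>g. L2 g \<and> weak_pd i f g" using assms by (simp add: H1_def)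
  from someI_ex[OF this] show "L2 (wgrad i f)" "weak_pd i f (wgrad i f)" by (auto simp: wgrad_def)
qed

text \<open>\<open>wgrad\<close> selects some representative, so nothing can be computed from its
  definition. Sums, translates and limits are handled by exhibiting an explicit weak derivative and
  comparing almost everywhere.\<close>

lemma wgrad_AE:
  assumes "L2 g" "weak_pd i f g" "H1 f"
  shows "AE x in lborel. wgrad i f x = g x"
  using weak_pd_unique[OF wgrad_spec(1)[OF \<open>H1 f\<close>] assms(1) wgrad_spec(2)[OF \<open>H1 f\<close>] assms(2)] .

lemma H1_L2: "H1 f \<Longrightarrow> L2 f" by (simp add: H1_def)

lemma H1_comb:
  assumes "H1 f" "H1 g" shows "H1 (\<lambda>x. f x + c * g x)"
  unfolding H1_def
proof (intro conjI allI exI)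
  show "L2 (\<lambda>x. f x + c * g x)" using assms by (intro L2_comb H1_L2)
  show "L2 (\<lambda>x. wgrad i f x + c * wgrad i g x)" for i using assms by (intro L2_comb wgrad_spec)
  show "weak_pd i (\<lambda>x. f x + c * g x) (\<lambda>x. wgrad i f x + c * wgrad i g x)" for i
    using assms by (intro weak_pd_comb wgrad_spec H1_L2)
qed

lemma wgrad_comb:
  assumes "H1 f" "H1 g"
  shows "AE x in lborel. wgrad i (\<lambda>x. f x + c * g x) x = wgrad i f x + c * wgrad i g x"
  using assms
  by (intro wgrad_AE weak_pd_comb L2_comb wgrad_spec H1_L2 H1_comb)

interpretation H1: form_space "Collect H1" kin_form
proof
  fix f g h :: "real^'n \<Rightarrow> complex" and c
  \<comment> \<open>box 0 0 is empty, so its bump is the zero function\<close>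
  have "test_fun (box_bump (0::real^'n) 0 0)" by (rule test_fun_box_bump)
  from test_fun_H1[OF this] show "(\<lambda>_::real^'n. 0) \<in> Collect H1" by (simp add: box_bump_eq_0)
  show "0 \<le> Re (kin_form f f)" by (simp add: kin_form_def inner_L2_self sum_nonneg)
  assume f: "f \<in> Collect H1" and g: "g \<in> Collect H1"
  then show "(\<lambda>x. f x + c * g x) \<in> Collect H1" by (simp add: H1_comb)
  show "kin_form g f = cnj (kin_form f g)"
    using f g by (simp add: kin_form_def wgrad_spec L2.B_cnj[of "wgrad _ f"])
  assume h: "h \<in> Collect H1"
  have "inner_L2 (wgrad i h) (wgrad i (\<lambda>x. f x + c * g x)) =
      inner_L2 (wgrad i h) (\<lambda>x. wgrad i f x + c * wgrad i g x)" for i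
    using f g h by (intro inner_L2_cong_AE wgrad_comb wgrad_spec H1_comb L2_comb) auto
  also have "inner_L2 (wgrad i h) (\<lambda>x. wgrad i f x + c * wgrad i g x) =
      inner_L2 (wgrad i h) (wgrad i f) + c * inner_L2 (wgrad i h) (wgrad i g)" for i
    using f g h by (intro L2.B_comb) (auto intro: wgrad_spec)
  finally have "inner_L2 (wgrad i h) (wgrad i (\<lambda>x. f x + c * g x)) =
      inner_L2 (wgrad i h) (wgrad i f) + c * inner_L2 (wgrad i h) (wgrad i g)" for i .
  then show "kin_form h (\<lambda>x. f x + c * g x) = kin_form h f + c * kin_form h g"
    by (simp add: kin_form_def sum.distrib sum_distrib_left)
qed

lemma Re_kin_form_self: "Re (kin_form f f) = (\<Sum>i\<in>UNIV. (norm_L2 (wgrad i f))\<^sup>2)"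
  by (simp add: kin_form_def inner_L2_self)

lemma wgrad_le_kin_form: "(norm_L2 (wgrad i f))\<^sup>2 \<le> Re (kin_form f f)"
  unfolding Re_kin_form_self by (intro member_le_sum) auto

lemma norm_L2_cong_AE:
  assumes "L2 f" "L2 g" "AE x in lborel. f x = g x" shows "norm_L2 f = norm_L2 g"
proof -
  have "(norm_L2 f)\<^sup>2 = (norm_L2 g)\<^sup>2"
    using inner_L2_cong_AE[OF assms(1,2,1,2,3,3)] unfolding inner_L2_self of_real_eq_iff .
  then show ?thesis by (rule power2_eq_imp_eq) auto
qed

text \<open>Stated as an equality of predicates, so that the choice in \<open>wgrad\<close> returns
  literally the same function for functions that agree almost everywhere.\<close>

lemma weak_pd_cong_AE:
  assumes "L2 f" "L2 f'" "AE x in lborel. f x = f' x"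
  shows "weak_pd i f = weak_pd i f'"
proof -
  note [measurable] = assms(1,2)[THEN L2_borel]
  have "(LINT x|lborel. f x * complex_of_real (pdiff i \<phi> x)) = (LINT x|lborel. f' x * complex_of_real (pdiff i \<phi> x))"
    if "test_fun \<phi>" for \<phi>
  proof (rule integral_cong_AE)
    note [measurable] = test_fun_borel[OF test_fun_pdiff[OF that, of i]]
    show "(\<lambda>x. f x * complex_of_real (pdiff i \<phi> x)) \<in> borel_measurable lborel"
      "(\<lambda>x. f' x * complex_of_real (pdiff i \<phi> x)) \<in> borel_measurable lborel" by measurable
    show "AE x in lborel. f x * complex_of_real (pdiff i \<phi> x) = f' x * complex_of_real (pdiff i \<phi> x)"
      using assms(3) by eventually_elim simp
  qed
  then show ?thesis by (auto simp: weak_pd_def fun_eq_iff)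
qed

text \<open>Against a fixed test function both sides are conjugated inner products, and these are
  continuous in the L2 norm.\<close>

lemma weak_pd_limit:
  assumes "\<And>n. L2 (d n)" "\<And>n. L2 (d' n)" "L2 f" "L2 g" "\<And>n. weak_pd i (d n) (d' n)"
    and lim: "(\<lambda>n. norm_L2 (d n - f)) \<longlonglongrightarrow> 0" "(\<lambda>n. norm_L2 (d' n - g)) \<longlonglongrightarrow> 0"
  shows "weak_pd i f g"
  unfolding weak_pd_def
proof (intro allI impI)
  fix \<phi> :: "real^'a \<Rightarrow> real" assume \<phi>: "test_fun \<phi>"
  have lim_pair: "(\<lambda>n. LINT x|lborel. u n x * complex_of_real (\<psi> x)) \<longlonglongrightarrow> (LINT x|lborel. v x * complex_of_real (\<psi> x))"
    if "\<And>n. L2 (u n)" "L2 v" "(\<lambda>n. norm_L2 (u n - v)) \<longlonglongrightarrow> 0" "test_fun \<psi>"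
    for u :: "nat \<Rightarrow> real^'a \<Rightarrow> complex" and v \<psi>
  proof -
    let ?p = "\<lambda>x. complex_of_real (\<psi> x)"
    have p: "L2 ?p" using test_fun_L2[OF that(4)] .
    have "(\<lambda>n. cnj (inner_L2 (u n) ?p)) \<longlonglongrightarrow> cnj (inner_L2 v ?p)"
      using inner_L2_tendsto[OF that(1,2) p that(3)] by (rule tendsto_cnj)
    moreover have "cnj (inner_L2 w ?p) = (LINT x|lborel. w x * ?p x)" if "L2 w" for w
      using L2.B_cnj[of w ?p] that p by (simp add: inner_L2_def mult.commute)
    ultimately show ?thesis using that(1,2) by simp
  qed
  have "(\<lambda>n. - (LINT x|lborel. d' n x * complex_of_real (\<phi> x))) \<longlonglongrightarrow> - (LINT x|lborel. g x * complex_of_real (\<phi> x))"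
    using lim_pair[OF assms(2,4) lim(2) \<phi>] by (rule tendsto_minus)
  moreover have "- (LINT x|lborel. d' n x * complex_of_real (\<phi> x)) = (LINT x|lborel. d n x * complex_of_real (pdiff i \<phi> x))" for n
    using assms(5) \<phi> by (simp add: weak_pd_def)
  ultimately show "(LINT x|lborel. f x * complex_of_real (pdiff i \<phi> x)) = - (LINT x|lborel. g x * complex_of_real (\<phi> x))"
    using LIMSEQ_unique[OF lim_pair[OF assms(1,3) lim(1) test_fun_pdiff[OF \<phi>, of i]]] by simp
qed

text \<open>The kinetic form bounds every partial derivative, so the gradients are Cauchy in L2 and
  have limits there; continuity of the pairing with test functions identifies these limits as weak
  derivatives of f.\<close>

lemma H1_Cauchy_limit:
  fixes d :: "nat \<Rightarrow> real^'n \<Rightarrow> complex"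
  assumes d: "\<And>n. H1 (d n)" and f: "L2 f" "(\<lambda>n. norm_L2 (d n - f)) \<longlonglongrightarrow> 0"
    and cauchy: "\<And>e. e > 0 \<Longrightarrow> \<exists>N. \<forall>n\<ge>N. \<forall>m\<ge>N. Re (kin_form (d n - d m) (d n - d m)) < e"
  shows "H1 f" "(\<lambda>n. Re (kin_form (d n - f) (d n - f))) \<longlonglongrightarrow> 0"
proof -
  have wdiff: "norm_L2 (wgrad i (u - v)) = norm_L2 (wgrad i u - wgrad i v)" if "H1 u" "H1 v" for u v :: "real^'n \<Rightarrow> complex" and i
    using wgrad_comb[OF that, of i "-1"] that H1.diff_mem[of u v]
    by (intro norm_L2_cong_AE L2_diff wgrad_spec) (auto simp: fun_diff_def)
  have "\<exists>g. L2 g \<and> (\<lambda>n. norm_L2 (wgrad i (d n) - g)) \<longlonglongrightarrow> 0" for i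
  proof -
    have "\<exists>N. \<forall>n\<ge>N. \<forall>m\<ge>N. (norm_L2 (wgrad i (d n) - wgrad i (d m)))\<^sup>2 < e" if e: "e > 0" for e
    proof -
      obtain N where N: "\<forall>n\<ge>N. \<forall>m\<ge>N. Re (kin_form (d n - d m) (d n - d m)) < e" using cauchy[OF e] by auto
      then show ?thesis
        using wgrad_le_kin_form[of i] wdiff[OF d d] by (metis le_less_trans)
    qed
    from L2_complete[OF wgrad_spec(1)[OF d] this] show ?thesis by blast
  qed
  then obtain g where g: "\<And>i. L2 (g i)" "\<And>i. (\<lambda>n. norm_L2 (wgrad i (d n) - g i)) \<longlonglongrightarrow> 0" by metis
  have w: "weak_pd i f (g i)" for i
    by (rule weak_pd_limit[OF H1_L2[OF d] wgrad_spec(1)[OF d] f(1) g(1) wgrad_spec(2)[OF d] f(2) g(2)])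
  then show H: "H1 f" using f g by (auto simp: H1_def)
  have "norm_L2 (wgrad i (d n - f)) = norm_L2 (wgrad i (d n) - g i)" for i n
    unfolding wdiff[OF d H] using wgrad_AE[OF g(1) w H, of i]
    by (intro norm_L2_cong_AE L2_diff wgrad_spec d H g) (auto elim: eventually_mono)
  then have "(\<lambda>n. Re (kin_form (d n - f) (d n - f))) = (\<lambda>n. \<Sum>i\<in>UNIV. (norm_L2 (wgrad i (d n) - g i))\<^sup>2)"
    by (simp add: Re_kin_form_self)
  also have "\<dots> \<longlonglongrightarrow> (\<Sum>i\<in>(UNIV::'n set). 0\<^sup>2)" by (intro tendsto_intros g)
  finally show "(\<lambda>n. Re (kin_form (d n - f) (d n - f))) \<longlonglongrightarrow> 0" by simp
qed

section \<open>Closed semibounded form sums\<close>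

lemma fs_quad_eq: "fs_quad c0 W f = c0 * Re (kin_form f f) + (LINT x|lborel. W x * (cmod (f x))\<^sup>2)"
proof -
  have "(LINT x|lborel. complex_of_real (W x) * cnj (f x) * f x) =
      (LINT x|lborel. complex_of_real (W x * (cmod (f x))\<^sup>2))"
    by (intro Bochner_Integration.integral_cong) (auto simp: complex_norm_square mult_ac simp del: of_real_power)
  then show ?thesis by (simp only: fs_quad_def fs_sesq_def integral_complex_of_real) simp
qed

lemma fs_dom_weighted_integrable:
  assumes [measurable]: "W \<in> borel_measurable borel" and f: "f \<in> fs_dom W" and h: "h \<in> fs_dom W"
  shows "integrable lborel (\<lambda>x. complex_of_real (W x) * cnj (f x) * h x)"
proof (rule Bochner_Integration.integrable_bound)
  have [measurable]: "f \<in> borel_measurable borel" "h \<in> borel_measurable borel"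
    using f h by (auto simp: fs_dom_def intro: L2_borel H1_L2)
  show "integrable lborel (\<lambda>x. \<bar>W x\<bar> * (cmod (f x))\<^sup>2 + \<bar>W x\<bar> * (cmod (h x))\<^sup>2)"
    using f h by (auto simp: fs_dom_def)
  show "(\<lambda>x. complex_of_real (W x) * cnj (f x) * h x) \<in> borel_measurable lborel" by measurable
  have "\<bar>W x\<bar> * (cmod (f x) * cmod (h x)) \<le> \<bar>W x\<bar> * ((cmod (f x))\<^sup>2 + (cmod (h x))\<^sup>2)" for x
    using sum_squares_bound[of "cmod (f x)" "cmod (h x)"] mult_nonneg_nonneg[OF norm_ge_zero norm_ge_zero, of "f x" "h x"]
    by (intro mult_left_mono) (linarith, simp)
  then show "AE x in lborel. norm (complex_of_real (W x) * cnj (f x) * h x) \<le>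
      norm (\<bar>W x\<bar> * (cmod (f x))\<^sup>2 + \<bar>W x\<bar> * (cmod (h x))\<^sup>2)"
    by (simp add: norm_mult ring_distribs mult.assoc)
qed

lemma fs_dom_comb:
  assumes [measurable]: "W \<in> borel_measurable borel" and f: "f \<in> fs_dom W" and h: "h \<in> fs_dom W"
  shows "(\<lambda>x. f x + c * h x) \<in> fs_dom W"
proof -
  have [measurable]: "f \<in> borel_measurable borel" "h \<in> borel_measurable borel"
    using f h by (auto simp: fs_dom_def intro: L2_borel H1_L2)
  have "integrable lborel (\<lambda>x. \<bar>W x\<bar> * (cmod (f x + c * h x))\<^sup>2)"
  proof (rule Bochner_Integration.integrable_bound)
    show "integrable lborel (\<lambda>x. 2 * (\<bar>W x\<bar> * (cmod (f x))\<^sup>2) + 2 * (cmod c)\<^sup>2 * (\<bar>W x\<bar> * (cmod (h x))\<^sup>2))"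
      using f h by (auto simp: fs_dom_def)
    have "\<bar>W x\<bar> * (cmod (f x + c * h x))\<^sup>2 \<le> 2 * (\<bar>W x\<bar> * (cmod (f x))\<^sup>2) + 2 * (cmod c)\<^sup>2 * (\<bar>W x\<bar> * (cmod (h x))\<^sup>2)" for x
      using mult_left_mono[OF cmod_comb_sq_le[of "f x" c "h x"] abs_ge_zero[of "W x"]] by (simp add: algebra_simps)
    then show "AE x in lborel. norm (\<bar>W x\<bar> * (cmod (f x + c * h x))\<^sup>2) \<le>
        norm (2 * (\<bar>W x\<bar> * (cmod (f x))\<^sup>2) + 2 * (cmod c)\<^sup>2 * (\<bar>W x\<bar> * (cmod (h x))\<^sup>2))" by simp
  qed measurable
  then show ?thesis using f h by (simp add: fs_dom_def H1_comb)
qed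

text \<open>In \<open>coercive\<close> half of the kinetic energy is given up, as a reserve for
  absorbing the negative part of W, and K pays for whatever the reserve does not cover. The last
  summand on the left makes the shifted form dominate the L2 norm, which the Riesz argument
  needs.\<close>

locale semibounded_form =
  fixes c0 K :: real and W :: "real^'n \<Rightarrow> real"
  assumes c0_pos: "c0 > 0" and K_nonneg: "K \<ge> 0" and W_borel [measurable]: "W \<in> borel_measurable borel"
    and test_fun_dom: "\<And>\<phi>. test_fun \<phi> \<Longrightarrow> (\<lambda>x. complex_of_real (\<phi> x)) \<in> fs_dom W"
    and coercive: "\<And>f. f \<in> fs_dom W \<Longrightarrow>
      c0 / 2 * Re (kin_form f f) + (LINT x|lborel. \<bar>W x\<bar> * (cmod (f x))\<^sup>2) + (norm_L2 f)\<^sup>2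
        \<le> fs_quad c0 W f + K * (norm_L2 f)\<^sup>2"
begin

definition B :: "(real^'n \<Rightarrow> complex) \<Rightarrow> (real^'n \<Rightarrow> complex) \<Rightarrow> complex" where
  "B f h = fs_sesq c0 W f h + complex_of_real K * inner_L2 f h"

lemma dom_H1: "f \<in> fs_dom W \<Longrightarrow> H1 f" and dom_L2: "f \<in> fs_dom W \<Longrightarrow> L2 f"
  by (auto simp: fs_dom_def H1_L2)

lemma Re_B_self: "Re (B f f) = fs_quad c0 W f + K * (norm_L2 f)\<^sup>2"
  by (simp add: B_def fs_quad_def inner_L2_self)

lemma B_coercive:
  assumes "f \<in> fs_dom W"
  shows "(norm_L2 f)\<^sup>2 \<le> Re (B f f)" "c0 / 2 * Re (kin_form f f) \<le> Re (B f f)"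
    "(LINT x|lborel. \<bar>W x\<bar> * (cmod (f x))\<^sup>2) \<le> Re (B f f)"
proof -
  have "0 \<le> c0 / 2 * Re (kin_form f f)" using c0_pos H1.B_nonneg[of f] dom_H1[OF assms] by simp
  moreover have "0 \<le> (LINT x|lborel. \<bar>W x\<bar> * (cmod (f x))\<^sup>2)" by (intro integral_nonneg_AE) auto
  moreover have "0 \<le> (norm_L2 f)\<^sup>2" by simp
  moreover note Re_B_self[of f]
  ultimately show "(norm_L2 f)\<^sup>2 \<le> Re (B f f)" "c0 / 2 * Re (kin_form f f) \<le> Re (B f f)"
    "(LINT x|lborel. \<bar>W x\<bar> * (cmod (f x))\<^sup>2) \<le> Re (B f f)"
    using coercive[OF assms] by linarith+
qed

sublocale S: form_space "fs_dom W" B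
proof
  fix f g h c
  show "(\<lambda>_. 0) \<in> fs_dom W" using H1.zero_mem by (simp add: fs_dom_def)
  show "0 \<le> Re (B f f)" if "f \<in> fs_dom W" using B_coercive(1)[OF that] zero_le_power2 order_trans by blast
  assume f: "f \<in> fs_dom W" and g: "g \<in> fs_dom W"
  show "(\<lambda>x. f x + c * g x) \<in> fs_dom W" using f g by (rule fs_dom_comb[OF W_borel])
  have "(LINT x|lborel. complex_of_real (W x) * cnj (g x) * f x) = cnj (LINT x|lborel. complex_of_real (W x) * cnj (f x) * g x)"
    by (subst Bochner_Integration.integral_cnj[symmetric]) (simp add: mult_ac del: Bochner_Integration.integral_cnj)
  then show "B g f = cnj (B f g)"
    using f g H1.B_cnj[of f g] L2.B_cnj[of f g] by (simp add: B_def fs_sesq_def dom_H1 dom_L2)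
  assume h: "h \<in> fs_dom W"
  have "(LINT x|lborel. complex_of_real (W x) * cnj (h x) * (f x + c * g x)) =
      (LINT x|lborel. complex_of_real (W x) * cnj (h x) * f x + c * (complex_of_real (W x) * cnj (h x) * g x))"
    by (simp add: algebra_simps)
  also have "\<dots> = (LINT x|lborel. complex_of_real (W x) * cnj (h x) * f x) + c * (LINT x|lborel. complex_of_real (W x) * cnj (h x) * g x)"
    using fs_dom_weighted_integrable[OF W_borel h f] fs_dom_weighted_integrable[OF W_borel h g]
    by (subst Bochner_Integration.integral_add) auto
  finally show "B h (\<lambda>x. f x + c * g x) = B h f + c * B h g"
    using f g h H1.B_comb[of h f g c] L2.B_comb[of h f g c]
    by (simp add: B_def fs_sesq_def dom_H1 dom_L2 algebra_simps)
qed

text \<open>The given L2 limit f serves both limit theorems: directly for the kinetic form, and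
  through an almost everywhere convergent subsequence for the weight |W|.\<close>

lemma B_closed:
  assumes d: "\<And>n. d n \<in> fs_dom W" and f: "L2 f" and lim: "(\<lambda>n. norm_L2 (d n - f)) \<longlonglongrightarrow> 0"
    and cauchy: "\<And>e. e > 0 \<Longrightarrow> \<exists>N. \<forall>n\<ge>N. \<forall>m\<ge>N. Re (B (d n - d m) (d n - d m)) < e"
  shows "f \<in> fs_dom W" "(\<lambda>n. fs_quad c0 W (d n - f)) \<longlonglongrightarrow> 0"
proof -
  have kc: "\<exists>N. \<forall>n\<ge>N. \<forall>m\<ge>N. Re (kin_form (d n - d m) (d n - d m)) < e" if "e > 0" for e
  proof -
    have "c0 / 2 * e > 0" using that c0_pos by simp
    from cauchy[OF this] obtain N
      where N: "\<And>n m. n \<ge> N \<Longrightarrow> m \<ge> N \<Longrightarrow> Re (B (d n - d m) (d n - d m)) < c0 / 2 * e" by blast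
    have "Re (kin_form (d n - d m) (d n - d m)) < e" if "n \<ge> N" "m \<ge> N" for n m
    proof -
      have "c0 / 2 * Re (kin_form (d n - d m) (d n - d m)) < c0 / 2 * e"
        using le_less_trans[OF B_coercive(2)[OF S.diff_mem[OF d d]] N[OF that]] .
      then show ?thesis using c0_pos by simp
    qed
    then show ?thesis by blast
  qed
  have wc: "\<exists>N. \<forall>n\<ge>N. \<forall>m\<ge>N. (LINT x|lborel. \<bar>W x\<bar> * (cmod (d n x - d m x))\<^sup>2) < e" if pos: "e > 0" for e
  proof -
    obtain N where N: "\<And>n m. n \<ge> N \<Longrightarrow> m \<ge> N \<Longrightarrow> Re (B (d n - d m) (d n - d m)) < e"
      using cauchy[OF pos] by blast
    have "(LINT x|lborel. \<bar>W x\<bar> * (cmod (d n x - d m x))\<^sup>2) < e" if "n \<ge> N" "m \<ge> N" for n m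
      using le_less_trans[OF B_coercive(3)[OF S.diff_mem[OF d d]] N[OF that]] by simp
    then show ?thesis by blast
  qed
  obtain r where r: "strict_mono r" "AE x in lborel. (\<lambda>n. d (r n) x) \<longlonglongrightarrow> f x"
    by (rule norm_L2_AE_subseq[OF dom_L2[OF d] f lim]) (rule that)
  have int: "integrable lborel (\<lambda>x. \<bar>W x\<bar> * (cmod (d n x))\<^sup>2)" for n using d by (simp add: fs_dom_def)
  have Wb: "(\<lambda>x. \<bar>W x\<bar>) \<in> borel_measurable borel" by measurable
  note wl = weighted_Cauchy_limit[OF L2_borel[OF dom_L2[OF d]] L2_borel[OF f] Wb abs_ge_zero int r wc]
  note kl = H1_Cauchy_limit[OF dom_H1[OF d] f lim kc]
  show fd: "f \<in> fs_dom W" using kl(1) wl(1) by (simp add: fs_dom_def)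
  \<comment> \<open>W has no sign, so the form itself is not monotone in anything; its modulus is
    controlled by the kinetic term plus the |W|-integral, and both tend to 0.\<close>
  have "\<bar>fs_quad c0 W (d n - f)\<bar> \<le> c0 * Re (kin_form (d n - f) (d n - f)) + (LINT x|lborel. \<bar>W x\<bar> * (cmod (d n x - f x))\<^sup>2)" for n
  proof -
    have "\<bar>LINT x|lborel. W x * (cmod ((d n - f) x))\<^sup>2\<bar> \<le> (LINT x|lborel. \<bar>W x * (cmod ((d n - f) x))\<^sup>2\<bar>)"
      by (rule integral_abs_bound)
    moreover have "0 \<le> c0 * Re (kin_form (d n - f) (d n - f))"
      using c0_pos H1.B_nonneg[of "d n - f"] dom_H1[OF S.diff_mem[OF d fd]] by simp
    ultimately show ?thesis by (simp add: fs_quad_eq abs_mult)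
  qed
  then have bound: "norm (fs_quad c0 W (d n - f)) \<le> c0 * Re (kin_form (d n - f) (d n - f)) + (LINT x|lborel. \<bar>W x\<bar> * (cmod (d n x - f x))\<^sup>2)" for n
    by simp
  have "(\<lambda>n. c0 * Re (kin_form (d n - f) (d n - f)) + (LINT x|lborel. \<bar>W x\<bar> * (cmod (d n x - f x))\<^sup>2)) \<longlonglongrightarrow> c0 * 0 + 0"
    by (intro tendsto_intros kl(2) wl(2))
  then have lim0: "(\<lambda>n. c0 * Re (kin_form (d n - f) (d n - f)) + (LINT x|lborel. \<bar>W x\<bar> * (cmod (d n x - f x))\<^sup>2)) \<longlonglongrightarrow> 0"
    by simp
  show "(\<lambda>n. fs_quad c0 W (d n - f)) \<longlonglongrightarrow> 0"
    by (rule Lim_null_comparison[OF always_eventually[OF allI[OF bound]] lim0])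
qed

lemma orthogonal_dom_zero:
  assumes "L2 g" and orth: "\<And>h. h \<in> fs_dom W \<Longrightarrow> inner_L2 g h = 0"
  shows "AE x in lborel. g x = 0"
proof (rule test_fun_orthogonal_zero[OF \<open>L2 g\<close>])
  fix \<phi> :: "real^'n \<Rightarrow> real" assume \<phi>: "test_fun \<phi>"
  have "inner_L2 (\<lambda>x. complex_of_real (\<phi> x)) g = 0"
    using orth[OF test_fun_dom[OF \<phi>]] L2.B_cnj[of g "\<lambda>x. complex_of_real (\<phi> x)"] \<open>L2 g\<close> test_fun_L2[OF \<phi>] by simp
  then show "(LINT x|lborel. g x * complex_of_real (\<phi> x)) = 0" by (simp add: inner_L2_def mult.commute)
qed

lemma dense_dom: "dense_L2 (fs_dom W)"
  by (rule dense_L2I) (auto intro: S.zero_mem S.comb_mem orthogonal_dom_zero dom_L2)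

theorem form_sum_exists: "form_sum_exists c0 W"
  unfolding form_sum_exists_def
proof (intro conjI allI impI)
  show "dense_L2 (fs_dom W)" by (rule dense_dom)
  have "- K * (norm_L2 f)\<^sup>2 \<le> fs_quad c0 W f" if "f \<in> fs_dom W" for f
    using S.B_nonneg[OF that] by (simp add: Re_B_self)
  then show "\<exists>c. \<forall>f\<in>fs_dom W. c * (norm_L2 f)\<^sup>2 \<le> fs_quad c0 W f" by blast
  fix d :: "nat \<Rightarrow> real^'n \<Rightarrow> complex" and f
  assume d: "\<forall>n. d n \<in> fs_dom W" and f: "L2 f" and lim: "(\<lambda>n. norm_L2 (d n - f)) \<longlonglongrightarrow> 0"
    and cauchy: "\<forall>e>0. \<exists>N. \<forall>n\<ge>N. \<forall>m\<ge>N. \<bar>fs_quad c0 W (d n - d m)\<bar> < e"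
  \<comment> \<open>The Cauchy hypothesis concerns the unshifted form, which may be indefinite; the
    shift is small because the sequence converges in L2. Of e, one half goes to the form and a
    quarter to the distance of each of the two terms from f.\<close>
  have "\<exists>N. \<forall>n\<ge>N. \<forall>m\<ge>N. Re (B (d n - d m) (d n - d m)) < e" if e: "e > 0" for e
  proof -
    obtain N1 where N1: "\<forall>n\<ge>N1. \<forall>m\<ge>N1. \<bar>fs_quad c0 W (d n - d m)\<bar> < e / 2"
      using cauchy e half_gt_zero by blast
    have "(\<lambda>n. K * (2 * (norm_L2 (d n - f))\<^sup>2)) \<longlonglongrightarrow> K * (2 * 0\<^sup>2)" by (intro tendsto_intros lim)
    then have "\<forall>\<^sub>F n in sequentially. K * (2 * (norm_L2 (d n - f))\<^sup>2) < e / 4"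
      by (rule order_tendstoD(2)) (use e in simp)
    then obtain N2 where N2: "\<And>n. n \<ge> N2 \<Longrightarrow> K * (2 * (norm_L2 (d n - f))\<^sup>2) < e / 4"
      by (auto simp: eventually_sequentially)
    have "Re (B (d n - d m) (d n - d m)) < e" if "n \<ge> max N1 N2" "m \<ge> max N1 N2" for n m
    proof -
      have "K * (norm_L2 (d n - d m))\<^sup>2 \<le> K * (2 * (norm_L2 (d n - f))\<^sup>2 + 2 * (norm_L2 (d m - f))\<^sup>2)"
        using norm_L2_diff_sq_le[of "d n" f "d m"] d f K_nonneg norm_L2_minus_commute[of f "d m"]
        by (intro mult_left_mono) (auto simp: dom_L2)
      moreover have "fs_quad c0 W (d n - d m) < e / 2" using N1 that by (meson abs_less_iff max.boundedE)
      ultimately show ?thesis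
        using N2[of n] N2[of m] that by (simp add: Re_B_self distrib_left)
    qed
    then show ?thesis by blast
  qed
  from B_closed[OF _ f lim this] d
  show "f \<in> fs_dom W" "(\<lambda>n. fs_quad c0 W (d n - f)) \<longlonglongrightarrow> 0" by auto
qed

text \<open>The functional \<open>inner_L2 u\<close> is bounded for \<open>B\<close> because
  \<open>B\<close> dominates the L2 norm. For the same reason the Riesz sequence is Cauchy in L2,
  and closedness puts its L2 limit into the form domain with convergence in
  \<open>B\<close>.\<close>

lemma riesz:
  assumes u: "L2 u"
  obtains f where "f \<in> fs_dom W" "\<And>h. h \<in> fs_dom W \<Longrightarrow> B h f = inner_L2 h u"
proof -
  have l1: "inner_L2 u (\<lambda>x. g x + c * h x) = inner_L2 u g + c * inner_L2 u h"
    if "g \<in> fs_dom W" "h \<in> fs_dom W" for g h c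
    using that u by (intro L2.B_comb) (auto simp: dom_L2)
  have l2: "(cmod (inner_L2 u h))\<^sup>2 \<le> (norm_L2 u)\<^sup>2 * Re (B h h)" if "h \<in> fs_dom W" for h
  proof -
    have "(cmod (inner_L2 u h))\<^sup>2 \<le> (norm_L2 u)\<^sup>2 * (norm_L2 h)\<^sup>2"
      using L2.Cauchy_Schwarz[of u h] that u by (simp add: inner_L2_self dom_L2)
    also have "\<dots> \<le> (norm_L2 u)\<^sup>2 * Re (B h h)" using B_coercive(1)[OF that] by (intro mult_left_mono) auto
    finally show ?thesis .
  qed
  obtain d where d: "\<And>n. d n \<in> fs_dom W"
    and c: "\<And>e. e > 0 \<Longrightarrow> \<exists>N. \<forall>n\<ge>N. \<forall>m\<ge>N. Re (B (d n - d m) (d n - d m)) < e"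
    and l: "\<And>h. h \<in> fs_dom W \<Longrightarrow> (\<lambda>n. B (d n) h) \<longlonglongrightarrow> inner_L2 u h"
    by (rule S.riesz_sequence[OF l1 l2 zero_le_power2]) (assumption | rule that)+
  have c': "\<exists>N. \<forall>n\<ge>N. \<forall>m\<ge>N. (norm_L2 (d n - d m))\<^sup>2 < e" if "e > 0" for e
    using c[OF that] B_coercive(1)[OF S.diff_mem[OF d d]] by (meson le_less_trans)
  obtain f where f: "L2 f" and lim: "(\<lambda>n. norm_L2 (d n - f)) \<longlonglongrightarrow> 0"
    by (rule L2_complete[OF dom_L2[OF d] c']) (assumption | rule that)+
  note cl = B_closed[OF d f lim c]
  have "(\<lambda>n. fs_quad c0 W (d n - f) + K * (norm_L2 (d n - f))\<^sup>2) \<longlonglongrightarrow> 0 + K * 0\<^sup>2"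
    by (intro tendsto_intros cl(2) lim)
  then have lim0: "(\<lambda>n. Re (B (d n - f) (d n - f))) \<longlonglongrightarrow> 0" by (simp add: Re_B_self)
  have "B h f = inner_L2 h u" if h: "h \<in> fs_dom W" for h
  proof -
    have "B f h = inner_L2 u h"
      using LIMSEQ_unique[OF S.B_tendsto[OF d cl(1) h lim0] l[OF h]] .
    then show ?thesis using S.B_cnj[OF cl(1) h] L2.B_cnj[of u h] u h by (simp add: dom_L2)
  qed
  with cl(1) show thesis by (rule that)
qed

text \<open>With T for the operator, adding K times the inner product on both sides turns T f = u
  into (T + K) f = u + K f, the kind of equation that the Riesz representation solves.\<close>

lemma fs_op_iff:
  "fs_op c0 W f u \<longleftrightarrow> f \<in> fs_dom W \<and> L2 u \<and>
    (\<forall>h\<in>fs_dom W. B h f = inner_L2 h (\<lambda>x. u x + complex_of_real K * f x))"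
proof -
  have "fs_sesq c0 W h f = inner_L2 h u \<longleftrightarrow> B h f = inner_L2 h (\<lambda>x. u x + complex_of_real K * f x)"
    if "f \<in> fs_dom W" "L2 u" "h \<in> fs_dom W" for h
    using that L2.B_comb[of h u f "complex_of_real K"] by (simp add: B_def dom_L2)
  then show ?thesis by (auto simp: fs_op_def)
qed

text \<open>The Riesz vector of v solves (T + K) f = v, hence T f = v - K f; the difference is
  spelled as a sum with a scalar multiple to match \<open>L2_comb\<close>.\<close>

lemma fs_op_surj:
  assumes v: "L2 v"
  obtains f where "f \<in> fs_dom W" "\<And>h. h \<in> fs_dom W \<Longrightarrow> B h f = inner_L2 h v"
    "fs_op c0 W f (\<lambda>x. v x + - complex_of_real K * f x)"
proof -
  obtain f where f: "f \<in> fs_dom W" "\<And>h. h \<in> fs_dom W \<Longrightarrow> B h f = inner_L2 h v"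
    by (rule riesz[OF v]) (rule that)
  have "L2 (\<lambda>x. v x + - complex_of_real K * f x)" using L2_comb[OF v dom_L2[OF f(1)]] .
  moreover have "(\<lambda>x. (v x + - complex_of_real K * f x) + complex_of_real K * f x) = v" by simp
  ultimately have "fs_op c0 W f (\<lambda>x. v x + - complex_of_real K * f x)"
    unfolding fs_op_iff using f by simp
  with f show thesis by (rule that)
qed

lemma fs_op_symmetric:
  assumes "fs_op c0 W f u" "fs_op c0 W g w"
  shows "inner_L2 u g = inner_L2 f w"
proof -
  have D: "f \<in> fs_dom W" "g \<in> fs_dom W" "L2 u" "L2 w" "L2 f" "L2 g" using assms by (auto simp: fs_op_def dom_L2)
  have "inner_L2 f w = B f g - complex_of_real K * inner_L2 f g"
    using assms(2) D by (simp add: fs_op_def B_def)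
  also have "\<dots> = cnj (B g f - complex_of_real K * inner_L2 g f)"
    using S.B_cnj[OF D(2,1)] L2.B_cnj[of g f] D by simp
  also have "B g f - complex_of_real K * inner_L2 g f = inner_L2 g u"
    using assms(1) D by (simp add: fs_op_def B_def)
  also have "cnj \<dots> = inner_L2 u g" using L2.B_cnj[of g u] D by simp
  finally show ?thesis by simp
qed

lemma fs_op_comb:
  assumes "fs_op c0 W f u" "fs_op c0 W g w"
  shows "fs_op c0 W (\<lambda>x. f x + c * g x) (\<lambda>x. u x + c * w x)"
proof -
  have D: "f \<in> fs_dom W" "g \<in> fs_dom W" "L2 u" "L2 w" "L2 f" "L2 g" using assms by (auto simp: fs_op_def dom_L2)
  have "fs_sesq c0 W h (\<lambda>x. f x + c * g x) = inner_L2 h (\<lambda>x. u x + c * w x)" if h: "h \<in> fs_dom W" for h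
    using S.B_comb[OF h D(1,2), of c] L2.B_comb[of h f g c] L2.B_comb[of h u w c] D h assms
    by (simp add: B_def dom_L2 fs_op_def algebra_simps)
  then show ?thesis using D by (simp add: fs_op_def S.comb_mem L2_comb)
qed

text \<open>For g orthogonal to the operator domain, solve (T + K) f = g. Then \<open>B f f\<close>
  is the inner product of f and g, which is 0, so by Cauchy-Schwarz \<open>B h f\<close> vanishes
  for all h. Thus g is orthogonal to the whole form domain, hence null.\<close>

lemma dense_op_dom: "dense_L2 {f. \<exists>u. fs_op c0 W f u}"
proof (rule dense_L2I)
  show "{f. \<exists>u. fs_op c0 W f u} \<subseteq> Collect L2" by (auto simp: fs_op_def dom_L2)
  have "inner_L2 h (\<lambda>_. 0) = 0" for h :: "real^'n \<Rightarrow> complex" by (simp add: inner_L2_def)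
  moreover have "B h (\<lambda>_. 0) = 0" if "h \<in> fs_dom W" for h
    using S.B_comb[OF that S.zero_mem S.zero_mem, of 1] by simp
  ultimately have "fs_op c0 W (\<lambda>_. 0) (\<lambda>_. 0)" by (simp add: fs_op_iff S.zero_mem L2_zero)
  then show "(\<lambda>_. 0) \<in> {f. \<exists>u. fs_op c0 W f u}" by blast
  show "(\<lambda>x. f x + c * g x) \<in> {f. \<exists>u. fs_op c0 W f u}"
    if "f \<in> {f. \<exists>u. fs_op c0 W f u}" "g \<in> {f. \<exists>u. fs_op c0 W f u}" for f g c
    using that by (auto dest: fs_op_comb)
  fix g :: "real^'n \<Rightarrow> complex"
  assume g: "L2 g" and orth: "\<And>h. h \<in> {f. \<exists>u. fs_op c0 W f u} \<Longrightarrow> inner_L2 g h = 0"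
  obtain f where f: "f \<in> fs_dom W" "\<And>h. h \<in> fs_dom W \<Longrightarrow> B h f = inner_L2 h g"
    and "fs_op c0 W f (\<lambda>x. g x + - complex_of_real K * f x)"
    by (rule fs_op_surj[OF g]) (rule that)
  then have "inner_L2 g f = 0" using orth by blast
  then have "B f f = 0" using f g L2.B_cnj[of g f] by (simp add: dom_L2)
  then have "B h f = 0" if "h \<in> fs_dom W" for h using S.Cauchy_Schwarz[OF that f(1)] by simp
  then have "inner_L2 g h = 0" if "h \<in> fs_dom W" for h
    using f(2)[OF that] that L2.B_cnj[of h g] g by (simp add: dom_L2)
  then show "AE x in lborel. g x = 0" by (rule orthogonal_dom_zero[OF g])
qed

text \<open>A symmetric T with T + K onto has no proper adjoint extension: if f0 solves (T + K) f0 =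
  w + K g, then g - f0 is orthogonal to the range of T + K, that is, to everything.\<close>

lemma adjoint_imp_fs_op:
  assumes "adjoint_rel (fs_op c0 W) g w" shows "fs_op c0 W g w"
proof -
  let ?k = "complex_of_real K"
  have g: "L2 g" and w: "L2 w" and adj: "\<And>f u. fs_op c0 W f u \<Longrightarrow> inner_L2 u g = inner_L2 f w"
    using assms by (auto simp: adjoint_rel_def)
  have v: "L2 (\<lambda>x. w x + ?k * g x)" using w g by (rule L2_comb)
  obtain f0 where f0: "f0 \<in> fs_dom W" "\<And>h. h \<in> fs_dom W \<Longrightarrow> B h f0 = inner_L2 h (\<lambda>x. w x + ?k * g x)"
      "fs_op c0 W f0 (\<lambda>x. (w x + ?k * g x) + - ?k * f0 x)"
    by (rule fs_op_surj[OF v]) (rule that)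
  let ?y = "\<lambda>x. (w x + ?k * g x) + - ?k * f0 x"
  have Lf0: "L2 f0" using f0 by (simp add: dom_L2)
  \<comment> \<open>Orthogonality to the range is tested on g - f0 itself, as the image of f under T
    + K.\<close>
  obtain f where f: "f \<in> fs_dom W" "\<And>h. h \<in> fs_dom W \<Longrightarrow> B h f = inner_L2 h (g - f0)"
      "fs_op c0 W f (\<lambda>x. (g - f0) x + - ?k * f x)"
    by (rule fs_op_surj[OF L2_diff[OF g Lf0]]) (rule that)
  let ?e = "g - f0"
  let ?u = "\<lambda>x. ?e x + - ?k * f x"
  have Le: "L2 ?e" and Lf: "L2 f" using g Lf0 f by (auto intro: L2_diff dom_L2)
  have kk: "cnj (- ?k) = - ?k" by simp
  have 1: "inner_L2 ?u g = inner_L2 f w" using adj[OF f(3)] .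
  have 2: "inner_L2 ?u f0 = inner_L2 f ?y" by (rule fs_op_symmetric[OF f(3) f0(3)])
  have 3: "inner_L2 ?u h = inner_L2 ?e h - ?k * inner_L2 f h" if "L2 h" for h
    using L2.B_comb_left[of h ?e f "- ?k"] that Le Lf unfolding kk by simp
  have 4: "inner_L2 f ?y = inner_L2 f w + ?k * inner_L2 f g - ?k * inner_L2 f f0"
    using L2.B_comb[of f "\<lambda>x. w x + ?k * g x" f0 "- ?k"] L2.B_comb[of f w g ?k] v Lf Lf0 w g by simp
  \<comment> \<open>Both sides equal \<open>inner_L2 f w + ?k * inner_L2 f g\<close>: the left by
    the adjoint relation, the right by symmetry of T.\<close>
  have "inner_L2 ?e g = inner_L2 ?e f0"
    using 3[OF g] 3[OF Lf0] unfolding 1 2 4 by (simp only: diff_eq_eq eq_diff_eq) simp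
  then have "inner_L2 ?e ?e = 0" using L2.B_diff[of ?e g f0] Le g Lf0 by simp
  then have "norm_L2 ?e = 0" by (simp add: inner_L2_self)
  then have "AE x in lborel. ?e x = 0" using norm_L2_zero_AE[OF Le] by simp
  then have ae: "AE x in lborel. f0 x = g x" by eventually_elim simp
  note [measurable] = L2_borel[OF g] L2_borel[OF Lf0]
  have wpd: "weak_pd i g = weak_pd i f0" for i using weak_pd_cong_AE[OF Lf0 g ae] by simp
  have wg: "wgrad i g = wgrad i f0" for i by (simp add: wgrad_def wpd)
  have "integrable lborel (\<lambda>x. \<bar>W x\<bar> * (cmod (f0 x))\<^sup>2) \<longleftrightarrow> integrable lborel (\<lambda>x. \<bar>W x\<bar> * (cmod (g x))\<^sup>2)"
    by (rule integrable_cong_AE) (use ae in \<open>auto elim: eventually_mono\<close>)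
  then have gd: "g \<in> fs_dom W" using f0(1) g by (simp add: fs_dom_def H1_def wpd)
  have "fs_sesq c0 W h g = inner_L2 h w" if h: "h \<in> fs_dom W" for h
  proof -
    note [measurable] = L2_borel[OF dom_L2[OF h]]
    have "(LINT x|lborel. complex_of_real (W x) * cnj (h x) * g x) = (LINT x|lborel. complex_of_real (W x) * cnj (h x) * f0 x)"
      by (rule integral_cong_AE) (use ae in \<open>auto elim: eventually_mono\<close>)
    then have "fs_sesq c0 W h g = fs_sesq c0 W h f0" by (simp add: fs_sesq_def kin_form_def wg)
    also have "\<dots> = inner_L2 h ?y" using f0(3) h by (simp add: fs_op_def)
    also have "\<dots> = inner_L2 h w"
    proof (rule inner_L2_cong_AE)
      show "L2 ?y" using v Lf0 by (rule L2_comb)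
      show "AE x in lborel. ?y x = w x" using ae by eventually_elim simp
    qed (use h w in \<open>auto simp: dom_L2\<close>)
    finally show ?thesis .
  qed
  then show ?thesis using gd w by (simp add: fs_op_def)
qed

theorem self_adjoint: "self_adjoint_rel (fs_op c0 W)"
proof -
  have "adjoint_rel (fs_op c0 W) f u" if "fs_op c0 W f u" for f u
    using that fs_op_symmetric[OF _ that] by (auto simp: adjoint_rel_def fs_op_def dom_L2)
  then show ?thesis
    unfolding self_adjoint_rel_def using dense_op_dom adjoint_imp_fs_op by blast
qed

theorem bounded_below: "op_bounded_below (fs_op c0 W)"
  unfolding op_bounded_below_def
proof (intro exI allI impI)
  fix f u assume fu: "fs_op c0 W f u"
  then have "Re (inner_L2 f u) = fs_quad c0 W f" by (simp add: fs_op_def fs_quad_def)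
  then show "- K * (norm_L2 f)\<^sup>2 \<le> Re (inner_L2 f u)"
    using S.B_nonneg[of f] fu by (simp add: Re_B_self fs_op_def)
qed

end

section \<open>Gaussian averages of potentials\<close>

text \<open>The Gaussian factorizes over the coordinates, and each factor is a multiple of a normal
  density.\<close>

lemma gaussian_integrable:
  assumes t: "t > 0"
  shows "integrable lborel (\<lambda>x::real^'n. exp (- t * (norm x)\<^sup>2))"
proof -
  have one: "integrable lborel (\<lambda>s::real. exp (- t * s\<^sup>2))"
  proof -
    \<comment> \<open>The variance is 1 / (2 t), so that the exponent s^2 / (2 \<sigma>^2) becomes t
      s^2.\<close>
    define \<sigma> where "\<sigma> = 1 / sqrt (2 * t)"
    have s2: "\<sigma>\<^sup>2 = 1 / (2 * t)" using t by (simp add: \<sigma>_def power_divide)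
    have "\<sigma> > 0" using t by (simp add: \<sigma>_def)
    then have "integrable lborel (\<lambda>s. sqrt (2 * pi * \<sigma>\<^sup>2) * normal_density 0 \<sigma> s)"
      by (intro integrable_mult_right integrable_normal_density)
    moreover have "sqrt (2 * pi * \<sigma>\<^sup>2) * normal_density 0 \<sigma> s = exp (- t * s\<^sup>2)" for s
      using t by (simp add: normal_density_def s2)
    ultimately show ?thesis by simp
  qed
  have "(\<integral>\<^sup>+x. ennreal (exp (- t * (norm (x::real^'n))\<^sup>2)) \<partial>lborel) =
      (\<integral>\<^sup>+x. (\<Prod>b\<in>Basis. ennreal (exp (- t * (x \<bullet> b)\<^sup>2))) \<partial>(lborel :: (real^'n) measure))"
  proof (rule nn_integral_cong)
    fix x :: "real^'n"
    have "(norm x)\<^sup>2 = (\<Sum>b\<in>Basis. (x \<bullet> b)\<^sup>2)"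
      unfolding power2_norm_eq_inner by (subst euclidean_inner) (simp add: power2_eq_square)
    then show "ennreal (exp (- t * (norm x)\<^sup>2)) = (\<Prod>b\<in>Basis. ennreal (exp (- t * (x \<bullet> b)\<^sup>2)))"
      by (simp add: prod_ennreal exp_sum[symmetric] sum_distrib_left sum_negf)
  qed
  also have "\<dots> = (\<Prod>b\<in>(Basis :: (real^'n) set). \<integral>\<^sup>+s. ennreal (exp (- t * s\<^sup>2)) \<partial>lborel)"
    by (rule nn_integral_lborel_prod) auto
  also have "\<dots> < \<infinity>"
    using nn_integral_eq_integral[OF one] by (simp add: ennreal_power less_top[symmetric])
  finally show ?thesis by (intro integrableI_nonneg) auto
qed

section \<open>Translation invariance of L2 and of the kinetic form\<close>

lemma has_derivative_translate:
  assumes "smooth_fun f"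
  shows "((\<lambda>x. f (x + t)) has_derivative frechet_derivative f (at (x + t))) (at x)"
proof (rule has_derivative_compose[of "\<lambda>x. x + t" "\<lambda>h. h", simplified])
  show "((\<lambda>x. x + t) has_derivative (\<lambda>h. h)) (at x)" by (auto intro!: derivative_eq_intros)
  show "(f has_derivative frechet_derivative f (at (x + t))) (at (x + t))"
    using smooth_fun_differentiable[OF assms] by (simp add: frechet_derivative_works[symmetric])
qed

lemma pdiff_translate: "smooth_fun f \<Longrightarrow> pdiff i (\<lambda>x. f (x + t)) x = pdiff i f (x + t)"
  by (simp add: pdiff_def frechet_derivative_at[OF has_derivative_translate, symmetric])

text \<open>Differentiation commutes with translation, so the translates of smooth functions are
  closed under partial derivatives, which is what the coinduction asks for.\<close>

lemma smooth_fun_translate: "smooth_fun f \<Longrightarrow> smooth_fun (\<lambda>x. f (x + t))"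
proof (coinduction arbitrary: f)
  case smooth_fun
  have "(\<lambda>x. f (x + t)) differentiable (at x)" for x
    using has_derivative_translate[OF smooth_fun] by (auto simp: differentiable_def)
  moreover have "frechet_derivative (\<lambda>x. f (x + t)) (at x) = frechet_derivative f (at (x + t))" for x
    using frechet_derivative_at[OF has_derivative_translate[OF smooth_fun]] by simp
  moreover have "smooth_fun (\<lambda>x. frechet_derivative f (at x) (axis i 1))" for i
    using smooth_fun_pdiff[OF smooth_fun] by (simp add: pdiff_def[abs_def])
  ultimately show ?case by fastforce
qed

lemma test_fun_translate:
  assumes "test_fun \<phi>" shows "test_fun (\<lambda>x. \<phi> (x + t))"
proof -
  have "{x. \<phi> (x + t) \<noteq> 0} = (\<lambda>x. x - t) ` {x. \<phi> x \<noteq> 0}"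
    by (auto simp: image_iff) (metis add_diff_cancel)
  then show ?thesis
    using assms smooth_fun_translate[of \<phi> t] bounded_translation_minus[of "{x. \<phi> x \<noteq> 0}" t] by (simp add: test_fun_def)
qed

lemma L2_translate:
  assumes "L2 f" shows "L2 (\<lambda>x. f (x + t))" "norm_L2 (\<lambda>x. f (x + t)) = norm_L2 f"
proof -
  note [measurable] = L2_borel[OF assms]
  show "L2 (\<lambda>x. f (x + t))"
    using assms lborel_translate(2)[of "\<lambda>x. (cmod (f x))\<^sup>2" t] by (simp add: L2_def)
  show "norm_L2 (\<lambda>x. f (x + t)) = norm_L2 f"
    using lborel_translate(1)[of "\<lambda>x. (cmod (f x))\<^sup>2" t] by (simp add: norm_L2_def)
qed

text \<open>The translation is moved onto the test function, where it commutes with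
  \<open>pdiff\<close>.\<close>

lemma weak_pd_translate:
  assumes "L2 f" "L2 g" "weak_pd i f g" shows "weak_pd i (\<lambda>x. f (x + t)) (\<lambda>x. g (x + t))"
  unfolding weak_pd_def
proof (intro allI impI)
  fix \<phi> :: "real^'a \<Rightarrow> real" assume \<phi>: "test_fun \<phi>"
  let ?\<psi> = "\<lambda>x. \<phi> (x + - t)"
  have \<psi>: "test_fun ?\<psi>" using \<phi> by (rule test_fun_translate)
  have pd: "pdiff i ?\<psi> = (\<lambda>x. pdiff i \<phi> (x + - t))"
    using \<phi> by (intro ext pdiff_translate) (simp add: test_fun_def)
  note [measurable] = assms(1,2)[THEN L2_borel] test_fun_borel[OF \<phi>] test_fun_borel[OF test_fun_pdiff[OF \<phi>, of i]]
  have "(LINT x|lborel. f (x + t) * complex_of_real (pdiff i \<phi> x)) = (LINT x|lborel. f x * complex_of_real (pdiff i ?\<psi> x))"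
    unfolding pd using lborel_translate(1)[of "\<lambda>x. f x * complex_of_real (pdiff i \<phi> (x + - t))" t] by simp
  also have "\<dots> = - (LINT x|lborel. g x * complex_of_real (?\<psi> x))"
    using assms(3) \<psi> by (simp only: weak_pd_def)
  also have "(LINT x|lborel. g x * complex_of_real (?\<psi> x)) = (LINT x|lborel. g (x + t) * complex_of_real (\<phi> x))"
    using lborel_translate(1)[of "\<lambda>x. g x * complex_of_real (\<phi> (x + - t))" t] by simp
  finally show "(LINT x|lborel. f (x + t) * complex_of_real (pdiff i \<phi> x)) = - (LINT x|lborel. g (x + t) * complex_of_real (\<phi> x))" .
qed

lemma H1_translate:
  assumes "H1 f" shows "H1 (\<lambda>x. f (x + t))" "Re (kin_form (\<lambda>x. f (x + t)) (\<lambda>x. f (x + t))) = Re (kin_form f f)"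
proof -
  let ?f = "\<lambda>x. f (x + t)"
  have w: "weak_pd i ?f (\<lambda>x. wgrad i f (x + t))" for i
    using assms by (intro weak_pd_translate H1_L2 wgrad_spec)
  have l: "L2 (\<lambda>x. wgrad i f (x + t))" for i by (rule L2_translate(1)[OF wgrad_spec(1)[OF assms]])
  have l0: "L2 ?f" by (rule L2_translate(1)[OF H1_L2[OF assms]])
  show H: "H1 ?f" using w l l0 by (auto simp: H1_def)
  have "norm_L2 (wgrad i ?f) = norm_L2 (\<lambda>x. wgrad i f (x + t))" for i
    by (rule norm_L2_cong_AE[OF wgrad_spec(1)[OF H] l wgrad_AE[OF l w H]])
  also have "\<And>i. norm_L2 (\<lambda>x. wgrad i f (x + t)) = norm_L2 (wgrad i f)"
    by (rule L2_translate(2)[OF wgrad_spec(1)[OF assms]])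
  finally show "Re (kin_form ?f ?f) = Re (kin_form f f)" by (simp add: Re_kin_form_self)
qed

section \<open>The Gaussian average of a potential\<close>

locale gaussian_smoothing =
  fixes a :: real and V :: "real^'n \<Rightarrow> real"
  assumes a_pos: "a > 0" and V_borel [measurable]: "V \<in> borel_measurable borel" and V2: "cond_V2 V"
begin

definition E :: "real^'n \<Rightarrow> real" where "E z = exp (- (norm z)\<^sup>2 / (4 * a))"
definition N :: real where "N = (4 * pi * a) powr (- real CARD('n) / 2)"
text \<open>The total mass of the normalized Gaussian, kept symbolic: it enters the estimates as a
  constant factor.\<close>

definition J :: real where "J = N * (LINT z|lborel. E z)"

lemma E_borel [measurable]: "E \<in> borel_measurable borel"
  unfolding E_def by measurable

lemma E_pos: "E z > 0" by (simp add: E_def)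

lemma N_pos: "N > 0" using a_pos by (simp add: N_def)

lemma E_integrable: "integrable lborel E"
  using gaussian_integrable[of "1 / (4 * a)"] a_pos by (simp add: E_def[abs_def])

lemma J_nonneg: "J \<ge> 0"
  unfolding J_def using N_pos E_pos by (intro mult_nonneg_nonneg integral_nonneg_AE) (auto simp: less_imp_le)

lemma W_eff_eq: "W_eff a V x = N * (LINT y|lborel. V y * E (x - y))"
  by (simp add: W_eff_def N_def E_def)

lemma W_eff_borel [measurable]: "W_eff a V \<in> borel_measurable borel"
proof -
  have "(\<lambda>x. LINT y|lborel. V y * E (x - y)) \<in> borel_measurable borel"
    by (rule lborel.borel_measurable_lebesgue_integral) measurable
  then show ?thesis unfolding W_eff_eq[abs_def] by measurable
qed

text \<open>From |y|^2 <= 2 |x - y|^2 + 2 |x|^2: the Gaussian centred at x is exchanged for one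
  centred at 0 with half the exponent, at the cost of a factor depending on x. So
  \<open>cond_V2\<close> at the single value t = 1 / (8 a) serves all x.\<close>

lemma E_diff_le: "E (x - y) \<le> exp ((norm x)\<^sup>2 / (4 * a)) * exp (- (1 / (8 * a)) * (norm y)\<^sup>2)"
proof -
  have "(norm y)\<^sup>2 \<le> (norm (x - y) + norm x)\<^sup>2"
    using norm_triangle_ineq4[of x "x - y"] by (intro power_mono) auto
  also have "\<dots> \<le> 2 * (norm (x - y))\<^sup>2 + 2 * (norm x)\<^sup>2"
    using sum_squares_bound[of "norm (x - y)" "norm x"] by (simp add: power2_sum)
  finally have "- (norm (x - y))\<^sup>2 / (4 * a) \<le> (norm x)\<^sup>2 / (4 * a) + - (1 / (8 * a)) * (norm y)\<^sup>2"
    using a_pos by (simp add: field_simps)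
  then show ?thesis unfolding E_def exp_add[symmetric] by simp
qed

lemma V_integrable: "integrable lborel (\<lambda>y. \<bar>V y\<bar> * exp (- (1 / (8 * a)) * (norm y)\<^sup>2))"
  using V2[unfolded cond_V2_def, rule_format, of "1 / (8 * a)"] a_pos by simp

lemma V_E_bound: "\<bar>V y * E (x - y)\<bar> \<le> exp ((norm x)\<^sup>2 / (4 * a)) * (\<bar>V y\<bar> * exp (- (1 / (8 * a)) * (norm y)\<^sup>2))"
  using mult_left_mono[OF E_diff_le[of x y] abs_ge_zero[of "V y"]] E_pos[of "x - y"] by (simp add: abs_mult mult_ac)

lemma V_E_integrable: "integrable lborel (\<lambda>y. V y * E (x - y))"
proof (rule Bochner_Integration.integrable_bound)
  show "integrable lborel (\<lambda>y. exp ((norm x)\<^sup>2 / (4 * a)) * (\<bar>V y\<bar> * exp (- (1 / (8 * a)) * (norm y)\<^sup>2)))"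
    using V_integrable by (rule integrable_mult_right)
  show "AE y in lborel. norm (V y * E (x - y)) \<le> norm (exp ((norm x)\<^sup>2 / (4 * a)) * (\<bar>V y\<bar> * exp (- (1 / (8 * a)) * (norm y)\<^sup>2)))"
    using V_E_bound by (intro AE_I2) (simp add: abs_mult)
qed measurable

text \<open>The growth of this bound in x is harmless on the bounded support of a test function,
  which is how test functions enter the form domain.\<close>

lemma W_eff_locally_bounded:
  "\<bar>W_eff a V x\<bar> \<le> N * (LINT y|lborel. \<bar>V y\<bar> * exp (- (1 / (8 * a)) * (norm y)\<^sup>2)) * exp ((norm x)\<^sup>2 / (4 * a))"
proof -
  have "\<bar>LINT y|lborel. V y * E (x - y)\<bar> \<le> (LINT y|lborel. \<bar>V y * E (x - y)\<bar>)"
    by (rule integral_abs_bound)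
  also have "\<dots> \<le> (LINT y|lborel. exp ((norm x)\<^sup>2 / (4 * a)) * (\<bar>V y\<bar> * exp (- (1 / (8 * a)) * (norm y)\<^sup>2)))"
    by (rule integral_mono[OF integrable_abs[OF V_E_integrable] integrable_mult_right[OF V_integrable] V_E_bound])
  also have "\<dots> = exp ((norm x)\<^sup>2 / (4 * a)) * (LINT y|lborel. \<bar>V y\<bar> * exp (- (1 / (8 * a)) * (norm y)\<^sup>2))"
    by (rule integral_mult_right_zero)
  finally have "N * \<bar>LINT y|lborel. V y * E (x - y)\<bar> \<le>
      N * (exp ((norm x)\<^sup>2 / (4 * a)) * (LINT y|lborel. \<bar>V y\<bar> * exp (- (1 / (8 * a)) * (norm y)\<^sup>2)))"
    using N_pos by (intro mult_left_mono) auto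
  then show ?thesis using N_pos by (simp add: W_eff_eq abs_mult mult_ac)
qed

lemma test_fun_in_dom:
  assumes \<phi>: "test_fun \<phi>" shows "(\<lambda>x. complex_of_real (\<phi> x)) \<in> fs_dom (W_eff a V)"
proof -
  note [measurable] = test_fun_borel[OF \<phi>]
  define I where "I = N * (LINT y|lborel. \<bar>V y\<bar> * exp (- (1 / (8 * a)) * (norm y)\<^sup>2))"
  have "integrable lborel (\<lambda>x. \<bar>W_eff a V x\<bar> * (cmod (complex_of_real (\<phi> x)))\<^sup>2)"
  proof (rule Bochner_Integration.integrable_bound)
    show "integrable lborel (\<lambda>x. (I * exp ((norm x)\<^sup>2 / (4 * a))) * (\<phi> x)\<^sup>2)"
    proof (rule continuous_bounded_support_integrable)
      show "continuous_on UNIV (\<lambda>x. (I * exp ((norm x)\<^sup>2 / (4 * a))) * (\<phi> x)\<^sup>2)"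
        using a_pos by (intro continuous_intros test_fun_continuous[OF \<phi>]) auto
      show "bounded {x. (I * exp ((norm x)\<^sup>2 / (4 * a))) * (\<phi> x)\<^sup>2 \<noteq> 0}"
        by (rule bounded_subset[of "{x. \<phi> x \<noteq> 0}"]) (use \<phi> in \<open>auto simp: test_fun_def\<close>)
    qed
    have "\<bar>W_eff a V x\<bar> * (\<phi> x)\<^sup>2 \<le> (I * exp ((norm x)\<^sup>2 / (4 * a))) * (\<phi> x)\<^sup>2" for x
      using W_eff_locally_bounded[of x] unfolding I_def by (intro mult_right_mono) auto
    then show "AE x in lborel. norm (\<bar>W_eff a V x\<bar> * (cmod (complex_of_real (\<phi> x)))\<^sup>2) \<le>
        norm ((I * exp ((norm x)\<^sup>2 / (4 * a))) * (\<phi> x)\<^sup>2)"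
      by (intro AE_I2) (auto intro: order_trans[OF _ abs_ge_self])
  qed measurable
  then show ?thesis using test_fun_H1[OF \<phi>] by (simp add: fs_dom_def)
qed

lemma W_eff_lower:
  assumes c: "\<And>x. c \<le> V x" shows "- (\<bar>c\<bar> * J) \<le> W_eff a V x"
proof -
  have tr: "E (x - y) = E (y + - x)" for y by (simp add: E_def norm_minus_commute)
  have iE: "integrable lborel (\<lambda>y. E (x - y))" "(LINT y|lborel. E (x - y)) = (LINT z|lborel. E z)"
    unfolding tr using E_integrable by (simp_all add: lborel_translate del: add_uminus_conv_diff)
  \<comment> \<open>The bound -|c| instead of c yields a lower bound -M with M >= 0, whatever the
    sign of c.\<close>
  have "(LINT y|lborel. - \<bar>c\<bar> * E (x - y)) \<le> (LINT y|lborel. V y * E (x - y))"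
  proof (rule integral_mono[OF integrable_mult_right[OF iE(1)] V_E_integrable])
    fix y
    have "- \<bar>c\<bar> \<le> V y" using c[of y] by linarith
    then show "- \<bar>c\<bar> * E (x - y) \<le> V y * E (x - y)" using E_pos[of "x - y"] by (intro mult_right_mono) auto
  qed
  then have "N * (- \<bar>c\<bar> * (LINT z|lborel. E z)) \<le> N * (LINT y|lborel. V y * E (x - y))"
    using N_pos iE(2) by (intro mult_left_mono) auto
  then show ?thesis by (simp add: W_eff_eq J_def mult_ac)
qed

text \<open>The hypothesis applies to every translate of f with the same e and b, because neither
  the kinetic form nor the norm changes; averaging against the Gaussian then costs only its mass
  \<open>J\<close>. Nonnegative integrals allow the exchanges before integrability is known, and
  their finite bound delivers it.\<close>

lemma W_eff_form_bound:
  assumes f: "H1 f"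
    and bound: "\<And>g. H1 g \<Longrightarrow> integrable lborel (\<lambda>x. \<bar>V x\<bar> * (cmod (g x))\<^sup>2) \<and>
       (LINT x|lborel. \<bar>V x\<bar> * (cmod (g x))\<^sup>2) \<le> e * Re (kin_form g g) + b * (norm_L2 g)\<^sup>2"
  shows "integrable lborel (\<lambda>x. \<bar>W_eff a V x\<bar> * (cmod (f x))\<^sup>2)"
    and "(LINT x|lborel. \<bar>W_eff a V x\<bar> * (cmod (f x))\<^sup>2) \<le> J * (e * Re (kin_form f f) + b * (norm_L2 f)\<^sup>2)"
proof -
  note [measurable] = L2_borel[OF H1_L2[OF f]]
  define T where "T = e * Re (kin_form f f) + b * (norm_L2 f)\<^sup>2"
  \<comment> \<open>b may be negative; T is nonnegative because it bounds the integral of a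
    nonnegative function.\<close>
  have T: "T \<ge> 0"
  proof -
    have "0 \<le> (LINT x|lborel. \<bar>V x\<bar> * (cmod (f x))\<^sup>2)" by (intro integral_nonneg_AE) auto
    then show ?thesis using bound[OF f] unfolding T_def by (meson order_trans)
  qed
  have shift: "(\<integral>\<^sup>+y. ennreal (\<bar>V y\<bar> * (cmod (f (y + z)))\<^sup>2) \<partial>lborel) \<le> ennreal T" for z
  proof -
    note b = bound[OF H1_translate(1)[OF f, of z]]
    have "(\<integral>\<^sup>+y. ennreal (\<bar>V y\<bar> * (cmod (f (y + z)))\<^sup>2) \<partial>lborel) =
        ennreal (LINT y|lborel. \<bar>V y\<bar> * (cmod (f (y + z)))\<^sup>2)"
      using b by (intro nn_integral_eq_integral) auto
    also have "\<dots> \<le> ennreal T"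
      using b H1_translate(2)[OF f, of z] L2_translate(2)[OF H1_L2[OF f], of z]
      by (intro ennreal_leI) (simp add: T_def)
    finally show ?thesis .
  qed
  have pointwise: "ennreal \<bar>W_eff a V x\<bar> \<le> (\<integral>\<^sup>+y. ennreal (N * \<bar>V y\<bar> * E (x - y)) \<partial>lborel)" for x
  proof -
    have "\<bar>W_eff a V x\<bar> \<le> (LINT y|lborel. N * \<bar>V y\<bar> * E (x - y))"
    proof -
      have "\<bar>LINT y|lborel. V y * E (x - y)\<bar> \<le> (LINT y|lborel. \<bar>V y * E (x - y)\<bar>)" by (rule integral_abs_bound)
      then have "N * \<bar>LINT y|lborel. V y * E (x - y)\<bar> \<le> N * (LINT y|lborel. \<bar>V y * E (x - y)\<bar>)"
        using N_pos by (intro mult_left_mono) auto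
      moreover have "\<bar>E z\<bar> = E z" for z using E_pos[of z] by simp
      ultimately show ?thesis using N_pos by (simp add: W_eff_eq abs_mult mult.assoc)
    qed
    also have "\<dots> = enn2real (\<integral>\<^sup>+y. ennreal (N * \<bar>V y\<bar> * E (x - y)) \<partial>lborel)"
      using N_pos E_pos by (intro integral_eq_nn_integral) (auto simp: less_imp_le)
    finally have "ennreal \<bar>W_eff a V x\<bar> \<le> ennreal (enn2real (\<integral>\<^sup>+y. ennreal (N * \<bar>V y\<bar> * E (x - y)) \<partial>lborel))"
      by (rule ennreal_leI)
    \<comment> \<open>\<open>enn2real\<close> sends infinity to 0, so this inequality does not
      depend on finiteness.\<close>
    also have "\<dots> \<le> (\<integral>\<^sup>+y. ennreal (N * \<bar>V y\<bar> * E (x - y)) \<partial>lborel)"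
      by (simp add: ennreal_enn2real_if)
    finally show ?thesis .
  qed
  have "(\<integral>\<^sup>+x. ennreal (\<bar>W_eff a V x\<bar> * (cmod (f x))\<^sup>2) \<partial>lborel) \<le>
      (\<integral>\<^sup>+x. (\<integral>\<^sup>+y. ennreal (N * \<bar>V y\<bar> * E (x - y)) * ennreal ((cmod (f x))\<^sup>2) \<partial>lborel) \<partial>lborel)"
  proof (rule nn_integral_mono)
    fix x
    have "ennreal (\<bar>W_eff a V x\<bar> * (cmod (f x))\<^sup>2) = ennreal \<bar>W_eff a V x\<bar> * ennreal ((cmod (f x))\<^sup>2)"
      by (simp add: ennreal_mult)
    also have "\<dots> \<le> (\<integral>\<^sup>+y. ennreal (N * \<bar>V y\<bar> * E (x - y)) \<partial>lborel) * ennreal ((cmod (f x))\<^sup>2)"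
      by (rule mult_right_mono[OF pointwise]) simp
    also have "\<dots> = (\<integral>\<^sup>+y. ennreal (N * \<bar>V y\<bar> * E (x - y)) * ennreal ((cmod (f x))\<^sup>2) \<partial>lborel)"
      by (rule nn_integral_multc[symmetric]) measurable
    finally show "ennreal (\<bar>W_eff a V x\<bar> * (cmod (f x))\<^sup>2) \<le> \<dots>" .
  qed
  also have "\<dots> = (\<integral>\<^sup>+y. (\<integral>\<^sup>+x. ennreal (N * \<bar>V y\<bar> * E (x - y)) * ennreal ((cmod (f x))\<^sup>2) \<partial>lborel) \<partial>lborel)"
    by (rule lborel_pair.Fubini') measurable
  \<comment> \<open>Substituting x = y + z at fixed y makes the Gaussian depend on z alone; after
    the second exchange, the integral at fixed z is that of a translate of f against |V|.\<close>
  also have "\<dots> = (\<integral>\<^sup>+y. (\<integral>\<^sup>+z. ennreal (N * E z) * ennreal (\<bar>V y\<bar> * (cmod (f (y + z)))\<^sup>2) \<partial>lborel) \<partial>lborel)"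
  proof (rule nn_integral_cong)
    fix y
    have d: "distr lborel borel ((+) y) = (lborel :: (real^'n) measure)" by (rule lborel_distr_plus)
    have "(\<integral>\<^sup>+x. ennreal (N * \<bar>V y\<bar> * E (x - y)) * ennreal ((cmod (f x))\<^sup>2) \<partial>lborel) =
      (\<integral>\<^sup>+z. ennreal (N * \<bar>V y\<bar> * E (y + z - y)) * ennreal ((cmod (f (y + z)))\<^sup>2) \<partial>lborel)"
      by (subst (1) d[symmetric], subst nn_integral_distr) auto
    also have "\<dots> = (\<integral>\<^sup>+z. ennreal (N * E z) * ennreal (\<bar>V y\<bar> * (cmod (f (y + z)))\<^sup>2) \<partial>lborel)"
      using N_pos E_pos by (intro nn_integral_cong) (simp add: ennreal_mult[symmetric] less_imp_le mult_ac)
    finally show "(\<integral>\<^sup>+x. ennreal (N * \<bar>V y\<bar> * E (x - y)) * ennreal ((cmod (f x))\<^sup>2) \<partial>lborel) = \<dots>" .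
  qed
  also have "\<dots> = (\<integral>\<^sup>+z. (\<integral>\<^sup>+y. ennreal (N * E z) * ennreal (\<bar>V y\<bar> * (cmod (f (y + z)))\<^sup>2) \<partial>lborel) \<partial>lborel)"
    by (rule lborel_pair.Fubini') measurable
  also have "\<dots> \<le> (\<integral>\<^sup>+z. ennreal (N * E z) * ennreal T \<partial>lborel)"
  proof (rule nn_integral_mono)
    fix z
    have "(\<integral>\<^sup>+y. ennreal (N * E z) * ennreal (\<bar>V y\<bar> * (cmod (f (y + z)))\<^sup>2) \<partial>lborel) =
        ennreal (N * E z) * (\<integral>\<^sup>+y. ennreal (\<bar>V y\<bar> * (cmod (f (y + z)))\<^sup>2) \<partial>lborel)"
      by (rule nn_integral_cmult) measurable
    also have "\<dots> \<le> ennreal (N * E z) * ennreal T" by (rule mult_left_mono[OF shift]) simp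
    finally show "(\<integral>\<^sup>+y. ennreal (N * E z) * ennreal (\<bar>V y\<bar> * (cmod (f (y + z)))\<^sup>2) \<partial>lborel) \<le> \<dots>" .
  qed
  also have "\<dots> = ennreal (LINT z|lborel. N * E z) * ennreal T"
    using N_pos E_pos E_integrable by (subst nn_integral_multc, measurable, subst nn_integral_eq_integral) (auto simp: less_imp_le)
  also have "\<dots> = ennreal (J * T)"
    using J_nonneg T by (simp add: J_def ennreal_mult)
  finally have le: "(\<integral>\<^sup>+x. ennreal (\<bar>W_eff a V x\<bar> * (cmod (f x))\<^sup>2) \<partial>lborel) \<le> ennreal (J * T)" .
  show i: "integrable lborel (\<lambda>x. \<bar>W_eff a V x\<bar> * (cmod (f x))\<^sup>2)"
    using le by (intro integrableI_nonneg) (auto simp: le_less_trans[OF _ ennreal_less_top])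
  have "ennreal (LINT x|lborel. \<bar>W_eff a V x\<bar> * (cmod (f x))\<^sup>2) \<le> ennreal (J * T)"
    using le nn_integral_eq_integral[OF i] by simp
  then show "(LINT x|lborel. \<bar>W_eff a V x\<bar> * (cmod (f x))\<^sup>2) \<le> J * (e * Re (kin_form f f) + b * (norm_L2 f)\<^sup>2)"
    using J_nonneg T by (simp add: ennreal_le_iff T_def)
qed

lemma weighted_integral_bound:
  "- (LINT x|lborel. \<bar>W x\<bar> * (cmod (f x))\<^sup>2) \<le> (LINT x|lborel. W x * (cmod (f x))\<^sup>2)"
  using integral_abs_bound[of lborel "\<lambda>x. W x * (cmod (f x))\<^sup>2"] by (simp add: abs_mult)

lemma W_eff_coercive:
  assumes V1: "cond_V1 V" and c0: "c0 > 0"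
  obtains K where "K \<ge> 0" "\<And>f. f \<in> fs_dom (W_eff a V) \<Longrightarrow>
      c0 / 2 * Re (kin_form f f) + (LINT x|lborel. \<bar>W_eff a V x\<bar> * (cmod (f x))\<^sup>2) + (norm_L2 f)\<^sup>2
        \<le> fs_quad c0 (W_eff a V) f + K * (norm_L2 f)\<^sup>2"
proof -
  let ?W = "W_eff a V"
  consider (bounded) "inf_form_bounded V" | (below) c where "\<And>x. c \<le> V x" using V1 by (auto simp: cond_V1_def)
  then show thesis
  proof cases
    case bounded
    \<comment> \<open>The |W|-integral A occurs twice, once in the claim and once as the bound -A
      for the potential part of the form, so A may use a quarter of c0 for half to remain. Hence J *
      e <= c0 / 4, where J + 1 avoids division by 0. Likewise the constant 2 * (J * |b|) + 1 below
      consists of twice the norm term of A and the extra squared norm.\<close>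
    define e where "e = c0 / (4 * (J + 1))"
    have e: "e > 0" "J * e \<le> c0 / 4" using c0 J_nonneg by (auto simp: e_def field_simps)
    obtain b where b: "\<And>g. H1 g \<Longrightarrow> integrable lborel (\<lambda>x. \<bar>V x\<bar> * (cmod (g x))\<^sup>2) \<and>
       (LINT x|lborel. \<bar>V x\<bar> * (cmod (g x))\<^sup>2) \<le> e * Re (kin_form g g) + b * (norm_L2 g)\<^sup>2"
      using bounded e(1) unfolding inf_form_bounded_def by blast
    show thesis
    proof (rule that[of "2 * (J * \<bar>b\<bar>) + 1"])
      show "0 \<le> 2 * (J * \<bar>b\<bar>) + 1" using J_nonneg by simp
      fix f assume "f \<in> fs_dom ?W"
      then have f: "H1 f" by (simp add: fs_dom_def)
      have k: "Re (kin_form f f) \<ge> 0" using H1.B_nonneg[of f] f by simp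
      have "(LINT x|lborel. \<bar>?W x\<bar> * (cmod (f x))\<^sup>2) \<le> J * (e * Re (kin_form f f) + b * (norm_L2 f)\<^sup>2)"
        by (rule W_eff_form_bound(2)[OF f b])
      also have "\<dots> = (J * e) * Re (kin_form f f) + (J * b) * (norm_L2 f)\<^sup>2" by (simp add: algebra_simps)
      also have "\<dots> \<le> c0 / 4 * Re (kin_form f f) + (J * \<bar>b\<bar>) * (norm_L2 f)\<^sup>2"
        using e k J_nonneg by (intro add_mono mult_right_mono mult_left_mono) auto
      finally show "c0 / 2 * Re (kin_form f f) + (LINT x|lborel. \<bar>?W x\<bar> * (cmod (f x))\<^sup>2) + (norm_L2 f)\<^sup>2
        \<le> fs_quad c0 ?W f + (2 * (J * \<bar>b\<bar>) + 1) * (norm_L2 f)\<^sup>2"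
        using weighted_integral_bound[of ?W f] unfolding fs_quad_eq by (simp add: algebra_simps)
    qed
  next
    case below
    define M where "M = \<bar>c\<bar> * J"
    have M: "M \<ge> 0" "\<And>x. - M \<le> ?W x" using J_nonneg W_eff_lower[OF below] by (auto simp: M_def)
    \<comment> \<open>W >= -M gives |W| <= W + 2 M, which costs 2 M squared norms; the 1 covers the
      extra squared norm, and the kinetic term only has to be nonnegative.\<close>
    show thesis
    proof (rule that[of "2 * M + 1"])
      show "0 \<le> 2 * M + 1" using M by simp
      fix f assume f: "f \<in> fs_dom ?W"
      have k: "Re (kin_form f f) \<ge> 0" using H1.B_nonneg[of f] f by (simp add: fs_dom_def)
      have L: "integrable lborel (\<lambda>x. (cmod (f x))\<^sup>2)" and [measurable]: "f \<in> borel_measurable borel"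
        using f by (auto simp: fs_dom_def H1_def L2_def)
      have i1: "integrable lborel (\<lambda>x. \<bar>?W x\<bar> * (cmod (f x))\<^sup>2)" using f by (simp add: fs_dom_def)
      have i2: "integrable lborel (\<lambda>x. ?W x * (cmod (f x))\<^sup>2)"
        by (rule Bochner_Integration.integrable_bound[OF i1]) (auto simp: abs_mult)
      have "(LINT x|lborel. \<bar>?W x\<bar> * (cmod (f x))\<^sup>2) \<le> (LINT x|lborel. ?W x * (cmod (f x))\<^sup>2 + 2 * M * (cmod (f x))\<^sup>2)"
      proof (rule integral_mono[OF i1])
        show "integrable lborel (\<lambda>x. ?W x * (cmod (f x))\<^sup>2 + 2 * M * (cmod (f x))\<^sup>2)" using i2 L by auto
        fix x
        have "\<bar>?W x\<bar> \<le> ?W x + 2 * M" using M(1) M(2)[of x] by linarith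
        then show "\<bar>?W x\<bar> * (cmod (f x))\<^sup>2 \<le> ?W x * (cmod (f x))\<^sup>2 + 2 * M * (cmod (f x))\<^sup>2"
          using mult_right_mono[of "\<bar>?W x\<bar>" "?W x + 2 * M" "(cmod (f x))\<^sup>2"] by (simp add: distrib_right)
      qed
      also have "\<dots> = (LINT x|lborel. ?W x * (cmod (f x))\<^sup>2) + 2 * M * (norm_L2 f)\<^sup>2"
        unfolding norm_L2_sq using i2 L by (subst Bochner_Integration.integral_add) auto
      finally show "c0 / 2 * Re (kin_form f f) + (LINT x|lborel. \<bar>?W x\<bar> * (cmod (f x))\<^sup>2) + (norm_L2 f)\<^sup>2
        \<le> fs_quad c0 ?W f + (2 * M + 1) * (norm_L2 f)\<^sup>2"
        using mult_nonneg_nonneg[OF less_imp_le[OF c0] k] unfolding fs_quad_eq by (simp add: algebra_simps)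
    qed
  qed
qed

end

section \<open>Positivity of the smoothing width, and the conclusion\<close>

theorem theorem4p2:
  fixes hbar m eps0 q :: real
    and \<omega> \<rho> :: "real^'n \<Rightarrow> real"
    and V :: "real^'n \<Rightarrow> real"
  assumes "CARD('n) \<ge> 2"
    and "hbar > 0" and "m > 0" and "eps0 > 0" and "q \<noteq> 0"
    and "\<omega> \<in> borel_measurable borel" and "\<forall>k. \<omega> k \<ge> 0" and "AE k in lborel. \<omega> k > 0"
    and "\<rho> \<in> borel_measurable borel"
    and "\<forall>k k'. norm k = norm k' \<longrightarrow> \<rho> k = \<rho> k'"
    and "integrable lborel (\<lambda>k. (\<rho> k / sqrt (\<omega> k))\<^sup>2)"
    and "\<not> (AE k in lborel. \<rho> k / sqrt (\<omega> k) = 0)"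
    and "integrable lborel (\<lambda>k. (\<rho> k / (\<omega> k) powr (3/2))\<^sup>2)"
    and "\<not> (AE k in lborel. \<rho> k / (\<omega> k) powr (3/2) = 0)"
    and "V \<in> borel_measurable borel"
    and "cond_V1 V" and "cond_V2 V"
  shows "let a = (real CARD('n) - 1) / (4 * real CARD('n)) * (hbar * q\<^sup>2 / (eps0 * m\<^sup>2)) *
                 (LINT k|lborel. (\<rho> k)\<^sup>2 / (\<omega> k) ^ 3);
             Veff = W_eff a V;
             c0 = hbar\<^sup>2 / (2 * m)
         in form_sum_exists c0 Veff \<and> self_adjoint_rel (fs_op c0 Veff) \<and> op_bounded_below (fs_op c0 Veff)"
proof -
  define I where "I = (LINT k|lborel. (\<rho> k)\<^sup>2 / (\<omega> k) ^ 3)"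
  define a where "a = (real CARD('n) - 1) / (4 * real CARD('n)) * (hbar * q\<^sup>2 / (eps0 * m\<^sup>2)) * I"
  define c0 where "c0 = hbar\<^sup>2 / (2 * m)"
  \<comment> \<open>Valid at every k: where \<omega> k = 0 both denominators are 0, and division by
    0 gives 0 on both sides.\<close>
  have sq: "(\<rho> k / (\<omega> k) powr (3/2))\<^sup>2 = (\<rho> k)\<^sup>2 / (\<omega> k) ^ 3" for k
  proof (cases "\<omega> k = 0")
    case False
    then have "\<omega> k > 0" using assms(7) by (simp add: order_less_le)
    then have "((\<omega> k) powr (3/2))\<^sup>2 = (\<omega> k) ^ 3"
      by (simp add: powr_power powr_numeral)
    then show ?thesis by (simp add: power_divide)
  qed simp
  have "I \<noteq> 0"
  proof
    assume "I = 0"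
    then have "(LINT k|lborel. (\<rho> k / (\<omega> k) powr (3/2))\<^sup>2) = 0" by (simp add: I_def sq)
    then have "AE k in lborel. (\<rho> k / (\<omega> k) powr (3/2))\<^sup>2 = 0"
      using integral_nonneg_eq_0_iff_AE[OF assms(13)] by simp
    then show False using assms(14) by simp
  qed
  moreover have "I \<ge> 0" unfolding I_def using assms(7) by (intro integral_nonneg_AE) auto
  ultimately have "I > 0" by simp
  \<comment> \<open>Dimension at least 2 makes the factor d - 1 positive, and q^2 is positive
    because q is nonzero.\<close>
  then have "a > 0" unfolding a_def using assms(1-5) by (intro mult_pos_pos divide_pos_pos) auto
  then interpret G: gaussian_smoothing a V using assms by unfold_locales
  have c0: "c0 > 0" using assms(2,3) by (simp add: c0_def)
  obtain K where K: "K \<ge> 0" "\<And>f. f \<in> fs_dom (W_eff a V) \<Longrightarrow>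
      c0 / 2 * Re (kin_form f f) + (LINT x|lborel. \<bar>W_eff a V x\<bar> * (cmod (f x))\<^sup>2) + (norm_L2 f)\<^sup>2
        \<le> fs_quad c0 (W_eff a V) f + K * (norm_L2 f)\<^sup>2"
    by (rule G.W_eff_coercive[OF assms(16) c0]) (rule that)
  interpret F: semibounded_form c0 K "W_eff a V"
    by unfold_locales (use c0 K G.W_eff_borel G.test_fun_in_dom in auto)
  show ?thesis
    unfolding Let_def I_def[symmetric] a_def[symmetric] c0_def[symmetric]
    using F.form_sum_exists F.self_adjoint F.bounded_below by blast
qed

end
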